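(* Assume the Mv-hinted Mv conjecture. Then for every $0<\tau<1$ and every constant $\varepsilon>0$, no dynamic algorithm with polynomial pre-processing time that maintains the product of three $n\times n$ (boolean) matrices under element updates and column queries can have worst-case update time $O(n^{\omega(1,1,\tau)-\tau-\varepsilon})$ and worst-case query time $O(n^{1+\tau-\varepsilon})$. The same lower bound holds for any element update, row query algorithm. With current bounds on $\omega$, balancing update and query time, this gives a lower bound of $\Omega(n^{1.529})$.
   Context: All computations are over the boolean semi-ring. For a matrix $N$ and a vector $I=(i_1,\dots,i_t)\in[n]^t$, $N_{[n],I}$ denotes the $n\times t$ matrix whose $k$-th column is the $i_k$-th column of $N$. The Mv-hinted Mv problem, for $t=n^\tau$ with $0<\tau<1$, has three phases: (1) input matrices $N\in\{0,1\}^{n\times n}$ and $V\in\{0,1\}^{t\times n}$; (2) input $I\in[n]^t$; (3) input an index $j\in[n]$ and output $N_{[n],I}V_{[t],j}$. The Mv-hinted Mv conjecture: for every $\varepsilon>0$, any algorithm solving this problem with polynomial pre-processing time in phase 1 requires $\Omega(n^{\omega(1,\tau,1)-\varepsilon})$ time in phase 2 or $\Omega(n^{1+\tau-\varepsilon})$ time in phase 3. $\omega(a,b,c)$ is the exponent of the cost of multiplying an $n^a\times n^b$ matrix by an $n^b\times n^c$ matrix (symmetric in its arguments).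
   Formalization: Current bounds on ω are only upper bounds and cannot give the n^1.529 lower bound; that claim is stated assuming ω(1,1,τ)−τ=1+τ at a τ with 1+τ within δ of 1.529, and excludes both times being O(n^(1.529−δ−ε)). *)

theory Defs
  imports Complex_Main "HOL-Library.Landau_Symbols"
begin

section \<open>Boolean matrices\<close>

text \<open>
  Dimensions vary inside the statements, so matrices and vectors are functions on indices
  counted from 0, and every operation carries the dimension it needs.
\<close>

type_synonym bvec = "nat \<Rightarrow> bool"
type_synonym bmat = "nat \<Rightarrow> nat \<Rightarrow> bool"

definition bmult :: "nat \<Rightarrow> bmat \<Rightarrow> bmat \<Rightarrow> bmat" where
  "bmult m A B = (\<lambda>i k. \<exists>j<m. A i j \<and> B j k)"

definition bmult_vec :: "nat \<Rightarrow> bmat \<Rightarrow> bvec \<Rightarrow> bvec" where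
  "bmult_vec m A v = (\<lambda>i. \<exists>j<m. A i j \<and> v j)"

definition select_cols :: "bmat \<Rightarrow> (nat \<Rightarrow> nat) \<Rightarrow> bmat" where
  "select_cols N I = (\<lambda>i k. N i (I k))"

definition column :: "bmat \<Rightarrow> nat \<Rightarrow> bvec" where
  "column M j = (\<lambda>i. M i j)"

definition row :: "bmat \<Rightarrow> nat \<Rightarrow> bvec" where
  "row M i = (\<lambda>j. M i j)"


section \<open>The exponent of rectangular matrix multiplication\<close>

text \<open>
  The cost of multiplying a \<open>p \<times> q\<close> by a \<open>q \<times> r\<close> matrix is the least number of arithmetic
  operations of a straight-line program over the reals.  Operands are entries of the two inputs,
  constants, or results of earlier operations.
\<close>

datatype operand = EntryX nat nat | EntryY nat nat | Cst real | Res nat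

datatype arith = AddOp | SubOp | MulOp

type_synonym slp = "(arith \<times> operand \<times> operand) list"

fun arith_val :: "arith \<Rightarrow> real \<Rightarrow> real \<Rightarrow> real" where
  "arith_val AddOp x y = x + y"
| "arith_val SubOp x y = x - y"
| "arith_val MulOp x y = x * y"

fun operand_val ::
  "(nat \<Rightarrow> nat \<Rightarrow> real) \<Rightarrow> (nat \<Rightarrow> nat \<Rightarrow> real) \<Rightarrow> real list \<Rightarrow> operand \<Rightarrow> real" where
  "operand_val X Y vs (EntryX i j) = X i j"
| "operand_val X Y vs (EntryY i j) = Y i j"
| "operand_val X Y vs (Cst c) = c"
| "operand_val X Y vs (Res k) = (if k < length vs then vs ! k else 0)"

fun slp_run ::
  "(nat \<Rightarrow> nat \<Rightarrow> real) \<Rightarrow> (nat \<Rightarrow> nat \<Rightarrow> real) \<Rightarrow> slp \<Rightarrow> real list \<Rightarrow> real list" where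
  "slp_run X Y [] vs = vs"
| "slp_run X Y ((f, a, b) # P) vs =
     slp_run X Y P (vs @ [arith_val f (operand_val X Y vs a) (operand_val X Y vs b)])"

definition slp_multiplies :: "nat \<Rightarrow> nat \<Rightarrow> nat \<Rightarrow> slp \<Rightarrow> (nat \<Rightarrow> nat \<Rightarrow> operand) \<Rightarrow> bool" where
  "slp_multiplies p q r P out \<longleftrightarrow>
     (\<forall>X Y. \<forall>i<p. \<forall>k<r.
        operand_val X Y (slp_run X Y P []) (out i k) = (\<Sum>j<q. X i j * Y j k))"

definition mm_cost :: "nat \<Rightarrow> nat \<Rightarrow> nat \<Rightarrow> nat" where
  "mm_cost p q r = (LEAST s. \<exists>P out. slp_multiplies p q r P out \<and> length P = s)"

definition npow :: "nat \<Rightarrow> real \<Rightarrow> nat" where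
  "npow n a = nat \<lceil>real n powr a\<rceil>"

definition omega :: "real \<Rightarrow> real \<Rightarrow> real \<Rightarrow> real" where
  "omega a b c =
     Inf {\<beta>. (\<lambda>n. real (mm_cost (npow n a) (npow n b) (npow n c))) \<in> O(\<lambda>n. real n powr \<beta>)}"


section \<open>Word RAM\<close>

text \<open>
  A program uses finitely many registers and finitely many arrays of words; both hold natural
  numbers below a bound \<open>W\<close>.  Finitely many arrays are a single memory up to address
  interleaving, and structured control flow is jumps up to constant factors.  Every instruction
  and every test costs one time unit.  An instruction whose result is not a word (is not below
  \<open>W\<close>) has no execution, so a program that runs is one that respects the word length.
\<close>

datatype binop = Add | Sub | Mul | Div | Mod | And | Or | Xor | Shl | Shr

fun binop_val :: "binop \<Rightarrow> nat \<Rightarrow> nat \<Rightarrow> nat" where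
  "binop_val Add x y = x + y"
| "binop_val Sub x y = x - y"
| "binop_val Mul x y = x * y"
| "binop_val Div x y = x div y"
| "binop_val Mod x y = x mod y"
| "binop_val And x y = semiring_bit_operations_class.and x y"
| "binop_val Or x y = semiring_bit_operations_class.or x y"
| "binop_val Xor x y = semiring_bit_operations_class.xor x y"
| "binop_val Shl x y = push_bit y x"
| "binop_val Shr x y = drop_bit y x"

datatype com =
    Skip
  | Const nat nat             \<comment> \<open>register := constant\<close>
  | Op nat binop nat nat      \<comment> \<open>register := register op register\<close>
  | Load nat nat nat          \<comment> \<open>register := array [register]\<close>
  | Store nat nat nat         \<comment> \<open>array [register] := register\<close>
  | Seq com com
  | If nat com com            \<comment> \<open>first branch if the register is nonzero\<close>
  | While nat com             \<comment> \<open>repeat while the register is nonzero\<close>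

record state =
  reg :: "nat \<Rightarrow> nat"
  arr :: "nat \<Rightarrow> nat \<Rightarrow> nat"

definition set_reg :: "nat \<Rightarrow> nat \<Rightarrow> state \<Rightarrow> state" where
  "set_reg r v s = s\<lparr>reg := (reg s)(r := v)\<rparr>"

definition set_arr :: "nat \<Rightarrow> nat \<Rightarrow> nat \<Rightarrow> state \<Rightarrow> state" where
  "set_arr a i v s = s\<lparr>arr := (arr s)(a := (arr s a)(i := v))\<rparr>"

text \<open>\<open>exec W c s T s'\<close>: started in \<open>s\<close>, program \<open>c\<close> halts after \<open>T\<close> steps in \<open>s'\<close>.\<close>

inductive exec :: "nat \<Rightarrow> com \<Rightarrow> state \<Rightarrow> nat \<Rightarrow> state \<Rightarrow> bool" for W :: nat where
  Skip: "exec W Skip s 1 s"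
| Const: "v < W \<Longrightarrow> exec W (Const r v) s 1 (set_reg r v s)"
| Op: "binop_val f (reg s x) (reg s y) < W \<Longrightarrow>
       exec W (Op r f x y) s 1 (set_reg r (binop_val f (reg s x) (reg s y)) s)"
| Load: "exec W (Load r a x) s 1 (set_reg r (arr s a (reg s x)) s)"
| Store: "exec W (Store a x y) s 1 (set_arr a (reg s x) (reg s y) s)"
| Seq: "exec W c s T s' \<Longrightarrow> exec W d s' T' s'' \<Longrightarrow> exec W (Seq c d) s (T + T') s''"
| IfTrue: "reg s x \<noteq> 0 \<Longrightarrow> exec W c s T s' \<Longrightarrow> exec W (If x c d) s (T + 1) s'"
| IfFalse: "reg s x = 0 \<Longrightarrow> exec W d s T s' \<Longrightarrow> exec W (If x c d) s (T + 1) s'"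
| WhileFalse: "reg s x = 0 \<Longrightarrow> exec W (While x c) s 1 s"
| WhileTrue: "reg s x \<noteq> 0 \<Longrightarrow> exec W c s T s' \<Longrightarrow> exec W (While x c) s' T' s'' \<Longrightarrow>
       exec W (While x c) s (T + T' + 1) s''"

text \<open>Words of \<open>O(log m)\<close> bits, the constant being \<open>e\<close>.\<close>

definition word_bound :: "nat \<Rightarrow> nat \<Rightarrow> nat" where
  "word_bound e m = (m + 2) ^ e"

text \<open>Row-major encoding of an \<open>p \<times> q\<close> matrix in an array.\<close>

definition encode_mat :: "nat \<Rightarrow> nat \<Rightarrow> bmat \<Rightarrow> nat \<Rightarrow> nat" where
  "encode_mat p q M = (\<lambda>a. of_bool (a < p * q \<and> M (a div q) (a mod q)))"

definition blank :: state where
  "blank = \<lparr>reg = (\<lambda>_. 0), arr = (\<lambda>_ _. 0)\<rparr>"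

text \<open>Answers are read from the first \<open>n\<close> cells of array 3.\<close>

definition outputs :: "nat \<Rightarrow> bvec \<Rightarrow> state \<Rightarrow> bool" where
  "outputs n v s \<longleftrightarrow> (\<forall>i<n. arr s 3 i = of_bool (v i))"

definition poly_bounded :: "(nat \<Rightarrow> nat) \<Rightarrow> bool" where
  "poly_bounded f \<longleftrightarrow> (\<exists>k::nat. (\<lambda>n. real (f n)) \<in> O(\<lambda>n. real n ^ k))"

definition time_exponent :: "(nat \<Rightarrow> nat) \<Rightarrow> real \<Rightarrow> bool" where
  "time_exponent f \<beta> \<longleftrightarrow> (\<lambda>n. real (f n)) \<in> O(\<lambda>n. real n powr \<beta>)"


section \<open>The Mv-hinted Mv problem\<close>

text \<open>
  Phase 1 gets \<open>n\<close>, \<open>t\<close> in registers 0, 1 and \<open>N\<close>, \<open>V\<close> in arrays 0, 1; phase 2 gets \<open>I\<close> in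
  array 2; phase 3 gets \<open>j\<close> in register 2.  All other memory is kept between the phases.
\<close>

definition hint_start :: "nat \<Rightarrow> nat \<Rightarrow> bmat \<Rightarrow> bmat \<Rightarrow> state" where
  "hint_start n t N V = blank
     \<lparr>reg := (\<lambda>_. 0)(0 := n, 1 := t),
      arr := (\<lambda>_ _. 0)(0 := encode_mat n n N, 1 := encode_mat t n V)\<rparr>"

definition hint_give_I :: "nat \<Rightarrow> (nat \<Rightarrow> nat) \<Rightarrow> state \<Rightarrow> state" where
  "hint_give_I t I s = s\<lparr>arr := (arr s)(2 := (\<lambda>a. if a < t then I a else arr s 2 a))\<rparr>"

definition solves_mv_hinted_mv ::
  "real \<Rightarrow> com \<Rightarrow> com \<Rightarrow> com \<Rightarrow> (nat \<Rightarrow> nat) \<Rightarrow> (nat \<Rightarrow> nat) \<Rightarrow> (nat \<Rightarrow> nat) \<Rightarrow> bool" where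
  "solves_mv_hinted_mv \<tau> P1 P2 P3 f1 f2 f3 \<longleftrightarrow>
     (\<exists>e. \<forall>n\<ge>1. \<forall>N V.
        let t = npow n \<tau>; W = word_bound e n in
        \<exists>T1 s1. exec W P1 (hint_start n t N V) T1 s1 \<and> T1 \<le> f1 n \<and>
          (\<forall>I. (\<forall>k<t. I k < n) \<longrightarrow>
            (\<exists>T2 s2. exec W P2 (hint_give_I t I s1) T2 s2 \<and> T2 \<le> f2 n \<and>
              (\<forall>j<n. \<exists>T3 s3. exec W P3 (set_reg 2 j s2) T3 s3 \<and> T3 \<le> f3 n \<and>
                 outputs n (bmult_vec t (select_cols N I) (column V j)) s3))))"

text \<open>
  ``Every algorithm needs \<open>\<Omega>(f)\<close> in phase 2 or \<open>\<Omega>(g)\<close> in phase 3'' cannot be read as an eventual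
  lower bound on one of the two times: an algorithm may trade the phases against each other
  depending on the parity of \<open>n\<close>.  As the claim is made for every \<open>\<epsilon> > 0\<close>, it is rendered as
  usual: no algorithm meets both bounds as upper bounds.
\<close>

definition mv_hinted_mv_conjecture :: bool where
  "mv_hinted_mv_conjecture \<longleftrightarrow>
     (\<forall>\<tau> \<epsilon>. 0 < \<tau> \<and> \<tau> < 1 \<and> 0 < \<epsilon> \<longrightarrow>
        \<not> (\<exists>P1 P2 P3 f1 f2 f3.
              solves_mv_hinted_mv \<tau> P1 P2 P3 f1 f2 f3 \<and> poly_bounded f1 \<and>
              time_exponent f2 (omega 1 \<tau> 1 - \<epsilon>) \<and> time_exponent f3 (1 + \<tau> - \<epsilon>)))"


section \<open>Dynamic product of three matrices\<close>

text \<open>\<open>Update m i j b\<close> sets entry \<open>(i, j)\<close> of the \<open>m\<close>-th factor (\<open>m < 3\<close>) to \<open>b\<close>.\<close>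

datatype request = Update nat nat nat bool | Query nat

fun valid_request :: "nat \<Rightarrow> request \<Rightarrow> bool" where
  "valid_request n (Update m i j b) \<longleftrightarrow> m < 3 \<and> i < n \<and> j < n"
| "valid_request n (Query j) \<longleftrightarrow> j < n"

definition set_entry :: "nat \<Rightarrow> nat \<Rightarrow> nat \<Rightarrow> bool \<Rightarrow> (nat \<Rightarrow> bmat) \<Rightarrow> nat \<Rightarrow> bmat" where
  "set_entry m i j b M = M(m := (M m)(i := (M m i)(j := b)))"

definition triple_product :: "nat \<Rightarrow> (nat \<Rightarrow> bmat) \<Rightarrow> bmat" where
  "triple_product n M = bmult n (bmult n (M 0) (M 1)) (M 2)"

datatype query_kind = ColumnQuery | RowQuery

fun answer :: "query_kind \<Rightarrow> bmat \<Rightarrow> nat \<Rightarrow> bvec" where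
  "answer ColumnQuery P j = column P j"
| "answer RowQuery P j = row P j"

text \<open>
  Pre-processing gets \<open>n\<close> in register 0 and the three factors in arrays 0, 1, 2.  An update gets
  its four parameters in registers 1 to 4, a query its index in register 1.  All other memory is
  kept between the operations.
\<close>

definition dyn_start :: "nat \<Rightarrow> (nat \<Rightarrow> bmat) \<Rightarrow> state" where
  "dyn_start n M = blank
     \<lparr>reg := (\<lambda>_. 0)(0 := n),
      arr := (\<lambda>a. if a < 3 then encode_mat n n (M a) else (\<lambda>_. 0))\<rparr>"

definition give_update :: "nat \<Rightarrow> nat \<Rightarrow> nat \<Rightarrow> bool \<Rightarrow> state \<Rightarrow> state" where
  "give_update m i j b s = set_reg 1 m (set_reg 2 i (set_reg 3 j (set_reg 4 (of_bool b) s)))"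

text \<open>
  \<open>serves knd e U Q u q n k M s rs\<close>: from machine state \<open>s\<close>, with current factors \<open>M\<close> and after
  \<open>k\<close> earlier requests, the update program \<open>U\<close> and the query program \<open>Q\<close> serve the requests \<open>rs\<close>
  in turn, correctly, within the time bounds \<open>u n\<close> and \<open>q n\<close> for each single request.  The word
  length is logarithmic in \<open>n + k\<close>, so that a counter of the requests always fits into a word.
\<close>

fun serves ::
  "query_kind \<Rightarrow> nat \<Rightarrow> com \<Rightarrow> com \<Rightarrow> (nat \<Rightarrow> nat) \<Rightarrow> (nat \<Rightarrow> nat) \<Rightarrow> nat \<Rightarrow> nat \<Rightarrow>
   (nat \<Rightarrow> bmat) \<Rightarrow> state \<Rightarrow> request list \<Rightarrow> bool" where
  "serves knd e U Q u q n k M s [] \<longleftrightarrow> True"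
| "serves knd e U Q u q n k M s (Update m i j b # rs) \<longleftrightarrow>
     (\<exists>T s'. exec (word_bound e (n + k)) U (give_update m i j b s) T s' \<and> T \<le> u n \<and>
        serves knd e U Q u q n (k + 1) (set_entry m i j b M) s' rs)"
| "serves knd e U Q u q n k M s (Query j # rs) \<longleftrightarrow>
     (\<exists>T s'. exec (word_bound e (n + k)) Q (set_reg 1 j s) T s' \<and> T \<le> q n \<and>
        outputs n (answer knd (triple_product n M) j) s' \<and>
        serves knd e U Q u q n (k + 1) M s' rs)"

definition maintains_triple_product ::
  "query_kind \<Rightarrow> com \<Rightarrow> com \<Rightarrow> com \<Rightarrow> (nat \<Rightarrow> nat) \<Rightarrow> (nat \<Rightarrow> nat) \<Rightarrow> (nat \<Rightarrow> nat) \<Rightarrow> bool" where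
  "maintains_triple_product knd P U Q p u q \<longleftrightarrow>
     (\<exists>e. \<forall>n\<ge>1. \<forall>M. \<exists>T s. exec (word_bound e n) P (dyn_start n M) T s \<and> T \<le> p n \<and>
        (\<forall>rs. list_all (valid_request n) rs \<longrightarrow> serves knd e U Q u q n 0 M s rs))"

definition has_dynamic_algorithm :: "query_kind \<Rightarrow> real \<Rightarrow> real \<Rightarrow> bool" where
  "has_dynamic_algorithm knd \<alpha> \<beta> \<longleftrightarrow>
     (\<exists>P U Q p u q. maintains_triple_product knd P U Q p u q \<and> poly_bounded p \<and>
        time_exponent u \<alpha> \<and> time_exponent q \<beta>)"

end

theory Submission
  imports Defs
begin

text \<open>
  The product \<open>N\<^bsub>[n],I\<^esub> V\<close> equals \<open>N S V\<close>, where \<open>S\<close> is the selection matrix of \<open>I\<close>,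
  so a dynamic algorithm for \<open>N 0 V\<close> solves the hinted problem: \<open>t\<close> updates turn \<open>0\<close> into
  \<open>S\<close> in phase 2, and one column query answers phase 3.  Row queries serve the transposed
  product.  The update cost is \<open>n\<^sup>\<tau>\<close> times \<open>n\<close> to the power \<open>\<omega>(1,1,\<tau>) - \<tau> - \<epsilon>\<close>, while
  the conjecture speaks of \<open>\<omega>(1,\<tau>,1)\<close>; the two exponents are compared by reverse mode
  differentiation of straight-line programs.
\<close>

section \<open>Rotating the shape of a matrix product\<close>

text \<open>The phase 2 budget is an exponent for shape \<open>(n, t, n)\<close>, while the
  \<open>t\<close> updates are charged at shape \<open>(n, n, t)\<close>. Transposition maps
  \<open>(n, t, n)\<close> to itself, so a genuine rotation is needed. It comes from the trilinear
  form trace(ZXY): a program for XY yields its value for every weight Z, and its gradient in Y is,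
  up to transposition, the product ZX. Only one inequality between the two exponents is required,
  together with a lower bound on the exponent that makes additive overheads negligible. On the
  machine side three things must be reconciled. The state after a request could a priori depend on
  later requests, which determinism excludes. The word length of the dynamic algorithm grows with
  the number of requests, but only \<open>t \<le> n\<close> updates and one query are ever issued.
  Finally, its programs may use any register and array, so they run under an injective renaming that
  leaves room for loop counters and for \<open>I\<close>.\<close>

type_synonym mat_fun = "(nat \<Rightarrow> nat \<Rightarrow> real) \<Rightarrow> (nat \<Rightarrow> nat \<Rightarrow> real) \<Rightarrow> real"

lemma slp_run_append: "slp_run X Y (P @ Q) vs = slp_run X Y Q (slp_run X Y P vs)"
  by (induction X Y P vs rule: slp_run.induct) auto

lemma length_slp_run [simp]: "length (slp_run X Y P vs) = length vs + length P"
  by (induction X Y P vs rule: slp_run.induct) auto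

lemma take_slp_run: "take (length vs) (slp_run X Y P vs) = vs"
proof (induction X Y P vs rule: slp_run.induct)
  case (2 X Y f a b P vs)
  let ?v = "arith_val f (operand_val X Y vs a) (operand_val X Y vs b)"
  have "take (length vs) (take (length (vs @ [?v])) (slp_run X Y P (vs @ [?v])))
      = take (length vs) (vs @ [?v])"
    by (simp only: 2)
  then show ?case
    by (simp add: min_def)
qed simp

text \<open>Instructions only append results, so instruction \<open>l\<close> sees exactly the first
  \<open>l\<close> entries of the final list.\<close>

lemma nth_slp_run:
  assumes l: "l < length P" and P: "P ! l = (f, a, b)"
  shows "slp_run X Y P [] ! l =
    arith_val f (operand_val X Y (take l (slp_run X Y P [])) a)
                (operand_val X Y (take l (slp_run X Y P [])) b)"
proof -
  define vs where "vs = slp_run X Y (take l P) []"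
  define v where "v = arith_val f (operand_val X Y vs a) (operand_val X Y vs b)"
  have len: "length vs = l"
    using l by (simp add: vs_def)
  have "P = take l P @ (f, a, b) # drop (Suc l) P"
    using l P by (metis id_take_nth_drop)
  then have run: "slp_run X Y P [] = slp_run X Y (drop (Suc l) P) (vs @ [v])"
    by (metis slp_run_append slp_run.simps(2) vs_def v_def)
  have t: "take (Suc l) (slp_run X Y P []) = vs @ [v]"
    using take_slp_run[of "vs @ [v]" X Y "drop (Suc l) P"] len run by simp
  have "take l (slp_run X Y P []) = take l (take (Suc l) (slp_run X Y P []))"
    by (simp add: min_def)
  then have "take l (slp_run X Y P []) = vs"
    using t len by simp
  moreover have "slp_run X Y P [] ! l = take (Suc l) (slp_run X Y P []) ! l"
    by simp
  then have "slp_run X Y P [] ! l = v"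
    using t len by (simp add: nth_append)
  ultimately show ?thesis
    by (simp add: v_def)
qed

text \<open>Stating only which functions are available after \<open>s\<close> operations lets
  programs be built by enlarging \<open>F\<close>, without tracking positions in instruction
  lists.\<close>

definition slp_computes :: "nat \<Rightarrow> mat_fun set \<Rightarrow> bool" where
  "slp_computes s F \<longleftrightarrow>
     (\<exists>P. length P \<le> s \<and> (\<forall>f\<in>F. \<exists>a. \<forall>X Y. operand_val X Y (slp_run X Y P []) a = f X Y))"

definition inputs :: "mat_fun set" where
  "inputs = {f. (\<exists>i j. f = (\<lambda>X Y. X i j)) \<or> (\<exists>i j. f = (\<lambda>X Y. Y i j)) \<or> (\<exists>c. f = (\<lambda>X Y. c))}"

lemma inputs_simps [simp]:
  "(\<lambda>X Y. X i j) \<in> inputs" "(\<lambda>X Y. Y i j) \<in> inputs" "(\<lambda>X Y. c) \<in> inputs"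
  by (auto simp: inputs_def)

lemma slp_computes_subset: "slp_computes s F \<Longrightarrow> G \<subseteq> F \<Longrightarrow> slp_computes s G"
  unfolding slp_computes_def by blast

lemma slp_computes_inputs:
  assumes "slp_computes s F"
  shows "slp_computes s (F \<union> inputs)"
proof -
  obtain P where P: "length P \<le> s"
      "\<And>f. f \<in> F \<Longrightarrow> \<exists>a. \<forall>X Y. operand_val X Y (slp_run X Y P []) a = f X Y"
    using assms unfolding slp_computes_def by blast
  have "\<exists>a. \<forall>X Y. operand_val X Y (slp_run X Y P []) a = f X Y" if "f \<in> inputs" for f
    using that unfolding inputs_def by (auto intro: exI[of _ "EntryX _ _"] exI[of _ "EntryY _ _"] exI[of _ "Cst _"])
  then show ?thesis
    unfolding slp_computes_def using P by blast
qed

lemma slp_computes_op: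
  assumes "slp_computes s F" and f: "f \<in> F" and g: "g \<in> F"
  shows "slp_computes (Suc s) (insert (\<lambda>X Y. arith_val c (f X Y) (g X Y)) F)"
proof -
  obtain P where P: "length P \<le> s"
      "\<And>f. f \<in> F \<Longrightarrow> \<exists>a. \<forall>X Y. operand_val X Y (slp_run X Y P []) a = f X Y"
    using assms(1) unfolding slp_computes_def by blast
  obtain a where a: "\<And>X Y. operand_val X Y (slp_run X Y P []) a = f X Y"
    using P(2)[OF f] by blast
  obtain b where b: "\<And>X Y. operand_val X Y (slp_run X Y P []) b = g X Y"
    using P(2)[OF g] by blast
  define Q where "Q = P @ [(c, a, b)]"
  have run: "slp_run X Y Q [] = slp_run X Y P [] @ [arith_val c (f X Y) (g X Y)]" for X Y
    by (simp add: Q_def slp_run_append a b)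
  have "\<exists>a. \<forall>X Y. operand_val X Y (slp_run X Y Q []) a = h X Y" if "h \<in> F" for h
  proof -
    obtain a where a: "\<And>X Y. operand_val X Y (slp_run X Y P []) a = h X Y"
      using P(2) \<open>h \<in> F\<close> by blast
    \<comment> \<open>A dangling operand reads as 0 but would refer to a result of the longer program.\<close>
    define a' where "a' = (case a of Res k \<Rightarrow> if k < length P then a else Cst 0 | _ \<Rightarrow> a)"
    have "operand_val X Y (slp_run X Y Q []) a' = operand_val X Y (slp_run X Y P []) a" for X Y
      by (cases a) (auto simp: a'_def run nth_append)
    then show ?thesis
      using a by auto
  qed
  moreover have "operand_val X Y (slp_run X Y Q []) (Res (length P)) = arith_val c (f X Y) (g X Y)"
    for X Y by (simp add: run nth_append)
  ultimately show ?thesis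
    unfolding slp_computes_def using P(1) by (intro exI[of _ Q] conjI) (auto simp: Q_def simp del: operand_val.simps)
qed

lemma slp_computes_muladd:
  assumes "slp_computes s F" and "f \<in> F \<union> inputs" "g \<in> F \<union> inputs" "h \<in> F \<union> inputs"
  shows "slp_computes (s + 2) (insert (\<lambda>X Y. f X Y + g X Y * h X Y) F)"
proof -
  let ?m = "\<lambda>X Y. arith_val MulOp (g X Y) (h X Y)"
  have "slp_computes (Suc s) (insert ?m (F \<union> inputs))"
    using assms by (intro slp_computes_op slp_computes_inputs)
  then have "slp_computes (Suc (Suc s)) (insert (\<lambda>X Y. arith_val AddOp (f X Y) (?m X Y))
      (insert ?m (F \<union> inputs)))"
    using assms(2) by (intro slp_computes_op[of "Suc s"]) auto
  then show ?thesis
    by (auto intro: slp_computes_subset)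
qed

section \<open>Upper and lower bounds on the cost of a matrix product\<close>

lemma slp_multiplies_naive:
  "\<exists>P out. slp_multiplies p q r P out \<and> length P \<le> 2 * p * q * r"
proof -
  let ?g = "\<lambda>m (i, k). (\<lambda>X Y. \<Sum>j<m. X i j * Y j k) :: mat_fun"
  have dot: "slp_computes (s + 2 * m) (insert (?g m z) F)" if "slp_computes s F" for s m z F
  proof (induction m)
    case 0
    have "(\<lambda>X Y. 0) \<in> inputs"
      by (auto simp: inputs_def)
    then show ?case
      using slp_computes_inputs[OF that] by (auto intro: slp_computes_subset split: prod.splits)
  next
    case (Suc m)
    obtain i k where z: "z = (i, k)"
      by fastforce
    have "(\<lambda>X Y. X i m) \<in> inputs" "(\<lambda>X Y. Y m k) \<in> inputs"
      by (auto simp: inputs_def)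
    then have "slp_computes (s + 2 * m + 2)
       (insert (\<lambda>X Y. ?g m z X Y + X i m * Y m k) (insert (?g m z) F))"
      using Suc by (intro slp_computes_muladd) auto
    then show ?case
      by (auto simp: z intro: slp_computes_subset)
  qed
  have "slp_computes (card A * (2 * q)) (?g q ` A)" if "finite A" for A
    using that
  proof induction
    case empty
    then show ?case
      by (simp add: slp_computes_def)
  next
    case (insert z A)
    then show ?case
      using dot[OF insert.IH, of q z] by (simp add: algebra_simps)
  qed
  from this[of "{..<p} \<times> {..<r}"]
  obtain P where P: "length P \<le> p * r * (2 * q)"
    "\<And>i k. i < p \<Longrightarrow> k < r \<Longrightarrow>
        \<exists>a. \<forall>X Y. operand_val X Y (slp_run X Y P []) a = (\<Sum>j<q. X i j * Y j k)"
    unfolding slp_computes_def by (force simp: card_cartesian_product)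
  then obtain out where "\<And>i k. i < p \<Longrightarrow> k < r \<Longrightarrow>
        \<forall>X Y. operand_val X Y (slp_run X Y P []) (out i k) = (\<Sum>j<q. X i j * Y j k)"
    by metis
  then have "slp_multiplies p q r P out"
    unfolding slp_multiplies_def by blast
  then show ?thesis
    using P(1) by (auto simp: algebra_simps)
qed

lemma mm_cost_attained: "\<exists>P out. slp_multiplies p q r P out \<and> length P = mm_cost p q r"
  unfolding mm_cost_def by (rule LeastI_ex) (use slp_multiplies_naive in blast)

lemma mm_cost_le: "slp_multiplies p q r P out \<Longrightarrow> mm_cost p q r \<le> length P"
  unfolding mm_cost_def by (rule Least_le) blast

lemma mm_cost_naive: "mm_cost p q r \<le> 2 * p * q * r"
  using slp_multiplies_naive mm_cost_le by (meson order_trans)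

text \<open>The four inputs with \<open>X\<close> and \<open>Y\<close> constantly 0 or 1 give 0, 0,
  0 and \<open>q\<close>. No entry, constant or dangling reference (which reads 0) behaves like this
  when \<open>q > 0\<close>.\<close>

lemma slp_multiplies_out:
  assumes "slp_multiplies p q r P out" "q > 0" "i < p" "k < r"
  shows "\<exists>m<length P. out i k = Res m"
proof -
  have *: "operand_val X Y (slp_run X Y P []) (out i k) = (\<Sum>j<q. X i j * Y j k)" for X Y
    using assms unfolding slp_multiplies_def by blast
  show ?thesis
    using \<open>q > 0\<close> *[of "\<lambda>_ _. 0" "\<lambda>_ _. 0"] *[of "\<lambda>_ _. 1" "\<lambda>_ _. 0"] *[of "\<lambda>_ _. 0" "\<lambda>_ _. 1"]
      *[of "\<lambda>_ _. 1" "\<lambda>_ _. 1"]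
    by (cases "out i k") (auto split: if_splits)
qed

text \<open>With \<open>X\<close> supported on row \<open>i\<close> and \<open>Y\<close> on column
  \<open>k\<close>, the product is nonzero at \<open>(i, k)\<close> only, so equal operands force
  equal positions.\<close>

lemma slp_multiplies_inj:
  assumes "slp_multiplies p q r P out" "q > 0" "i < p" "k < r" "i' < p" "k' < r"
    and eq: "out i k = out i' k'"
  shows "i = i' \<and> k = k'"
proof -
  define X :: "nat \<Rightarrow> nat \<Rightarrow> real" where "X = (\<lambda>a _. of_bool (a = i))"
  define Y :: "nat \<Rightarrow> nat \<Rightarrow> real" where "Y = (\<lambda>_ b. of_bool (b = k))"
  have "(\<Sum>j<q. X i j * Y j k) = (\<Sum>j<q. X i' j * Y j k')"
    using assms unfolding slp_multiplies_def by metis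
  then have "of_bool (i' = i) * of_bool (k' = k) = (1::real)"
    using \<open>q > 0\<close> by (simp add: X_def Y_def)
  then show ?thesis
    by (auto simp: of_bool_def split: if_splits)
qed

text \<open>The outputs are pairwise distinct results of operations, so there are at least as many
  operations as outputs.\<close>

lemma mm_cost_ge:
  assumes "q > 0"
  shows "p * r \<le> mm_cost p q r"
proof -
  obtain P out where P: "slp_multiplies p q r P out" and len: "length P = mm_cost p q r"
    using mm_cost_attained by blast
  have "card ((\<lambda>(i, k). out i k) ` ({..<p} \<times> {..<r})) = card ({..<p} \<times> {..<r})"
    by (rule card_image, rule inj_onI) (use slp_multiplies_inj[OF P assms] in auto)
  moreover have "(\<lambda>(i, k). out i k) ` ({..<p} \<times> {..<r}) \<subseteq> Res ` {..<length P}"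
    using slp_multiplies_out[OF P assms] by fastforce
  ultimately have "p * r \<le> card (Res ` {..<length P})"
    by (metis card_cartesian_product card_lessThan card_mono finite_imageI finite_lessThan)
  also have "\<dots> \<le> length P"
    using card_image_le[of "{..<length P}" Res] by simp
  finally show ?thesis
    by (simp add: len)
qed

section \<open>Differentiating a straight-line program\<close>

lemma slp_computes_results:
  "slp_computes (length P) ((\<lambda>m Z X. slp_run X (\<lambda>_ _. 0) P [] ! m) ` {..<length P})"
proof -
  \<comment> \<open>In the rotated product ZX the matrix X is the second input, so its entries
    change side; Y is frozen at 0.\<close>
  define h where "h = (\<lambda>a. case a of EntryX i j \<Rightarrow> EntryY i j | EntryY _ _ \<Rightarrow> Cst 0 | _ \<Rightarrow> a)"
  define Q where "Q = map (\<lambda>(f, a, b). (f, h a, h b)) P"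
  have h: "operand_val Z X vs (h a) = operand_val X (\<lambda>_ _. 0) vs a" for Z X vs a
    by (cases a) (auto simp: h_def)
  have "slp_run Z X (map (\<lambda>(f, a, b). (f, h a, h b)) P) vs = slp_run X (\<lambda>_ _. 0) P vs" for Z X vs
    by (induction P arbitrary: vs) (auto simp: h)
  then have run: "slp_run Z X Q [] = slp_run X (\<lambda>_ _. 0) P []" for Z X
    by (simp add: Q_def)
  show ?thesis
    unfolding slp_computes_def
  proof (intro exI[of _ Q] conjI ballI)
    fix f :: mat_fun
    assume "f \<in> (\<lambda>m Z X. slp_run X (\<lambda>_ _. 0) P [] ! m) ` {..<length P}"
    then obtain m where "m < length P" "f = (\<lambda>Z X. slp_run X (\<lambda>_ _. 0) P [] ! m)"
      by blast
    then have "\<forall>Z X. operand_val Z X (slp_run Z X Q []) (Res m) = f Z X"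
      by (simp add: run)
    then show "\<exists>a. \<forall>Z X. operand_val Z X (slp_run Z X Q []) a = f Z X"
      by blast
  qed (simp add: Q_def)
qed

fun tangent :: "nat \<Rightarrow> nat \<Rightarrow> (nat \<Rightarrow> real) \<Rightarrow> nat \<Rightarrow> operand \<Rightarrow> real" where
  "tangent j k d l (EntryX _ _) = 0"
| "tangent j k d l (EntryY j' k') = of_bool (j' = j \<and> k' = k)"
| "tangent j k d l (Cst _) = 0"
| "tangent j k d l (Res m) = (if m < l then d m else 0)"

fun partials :: "arith \<Rightarrow> real \<Rightarrow> real \<Rightarrow> real \<times> real" where
  "partials AddOp x y = (1, 1)"
| "partials SubOp x y = (1, -1)"
| "partials MulOp x y = (y, x)"

text \<open>Forward mode: the chain rule along the program at \<open>Y = 0\<close>, in the direction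
  of the unit matrix at \<open>(j, k)\<close>. These derivatives are never computed by a program;
  they only certify the reverse sweep. The guard \<open>m < l\<close> in \<open>tangent\<close>
  mirrors that a dangling reference reads the constant 0.\<close>

lemma slp_tangents:
  fixes X :: "nat \<Rightarrow> nat \<Rightarrow> real" and j k :: nat and P :: slp
  defines "Y \<equiv> \<lambda>e. (\<lambda>j' k'. e * of_bool (j' = j \<and> k' = k))"
  defines "val \<equiv> \<lambda>l. operand_val X (\<lambda>_ _. 0) (take l (slp_run X (\<lambda>_ _. 0) P []))"
  obtains d where
    "\<And>l. l < length P \<Longrightarrow> ((\<lambda>e. slp_run X (Y e) P [] ! l) has_real_derivative d l) (at 0)"
    "\<And>l f a b. l < length P \<Longrightarrow> P ! l = (f, a, b) \<Longrightarrow>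
       d l = fst (partials f (val l a) (val l b)) * tangent j k d l a
           + snd (partials f (val l a) (val l b)) * tangent j k d l b"
proof -
  \<comment> \<open>That the chosen value is a derivative is settled by induction in
    \<open>deriv\<close>; uniqueness of derivatives then turns it into the recursion.\<close>
  define d where "d = (\<lambda>l. SOME D. ((\<lambda>e. slp_run X (Y e) P [] ! l) has_real_derivative D) (at 0))"
  have Y0: "Y 0 = (\<lambda>_ _. 0)"
    by (auto simp: Y_def)
  have operand: "((\<lambda>e. operand_val X (Y e) (take l (slp_run X (Y e) P [])) a)
        has_real_derivative tangent j k d l a) (at 0)"
    if "l \<le> length P"
      and "\<And>m. m < l \<Longrightarrow> ((\<lambda>e. slp_run X (Y e) P [] ! m) has_real_derivative d m) (at 0)" for l a
  proof (cases a)
    case (EntryY j' k')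
    then show ?thesis
      by (auto simp: Y_def intro!: derivative_eq_intros)
  next
    case (Res m)
    then show ?thesis
      using that by auto
  qed auto
  have step: "((\<lambda>e. slp_run X (Y e) P [] ! l) has_real_derivative
       fst (partials f (val l a) (val l b)) * tangent j k d l a
     + snd (partials f (val l a) (val l b)) * tangent j k d l b) (at 0)"
    if l: "l < length P" and P: "P ! l = (f, a, b)"
      and "\<And>m. m < l \<Longrightarrow> ((\<lambda>e. slp_run X (Y e) P [] ! m) has_real_derivative d m) (at 0)"
    for l f a b
  proof -
    have "((\<lambda>e. operand_val X (Y e) (take l (slp_run X (Y e) P [])) c)
        has_real_derivative tangent j k d l c) (at 0)" for c
      using operand that by simp
    note this[of a, THEN DERIV_add, OF this[of b]] this[of a, THEN DERIV_diff, OF this[of b]]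
      this[of a, THEN DERIV_mult, OF this[of b]]
    then show ?thesis
      unfolding nth_slp_run[OF l P] by (cases f) (auto simp: val_def Y0 algebra_simps)
  qed
  have deriv: "((\<lambda>e. slp_run X (Y e) P [] ! l) has_real_derivative d l) (at 0)"
    if "l < length P" for l
    using that
  proof (induction l rule: less_induct)
    case (less l)
    obtain f a b where "P ! l = (f, a, b)"
      by (metis prod_cases3)
    from step[OF less.prems this] less show ?case
      by (auto simp: d_def intro: someI)
  qed
  show thesis
  proof (rule that[of d])
    fix l f a b
    assume l: "l < length P" and P: "P ! l = (f, a, b)"
    show "d l = fst (partials f (val l a) (val l b)) * tangent j k d l a
           + snd (partials f (val l a) (val l b)) * tangent j k d l b"
      using step[OF l P] deriv l by (meson DERIV_unique less_trans)
  qed (use deriv in auto)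
qed


text \<open>
  Reverse mode differentiation (Baur and Strassen).  The sum of all \<open>Z\<^sub>k\<^sub>i (XY)\<^sub>i\<^sub>k\<close> has
  the entries of \<open>ZX\<close> as its partial derivatives in the entries of \<open>Y\<close>; these are constant
  in \<open>Y\<close>, so it suffices to differentiate at \<open>Y = 0\<close>.
\<close>

lemma mm_cost_rotate:
  assumes q: "q > 0"
  shows "mm_cost r p q \<le> 5 * mm_cost p q r"
proof -
  obtain P out where P: "slp_multiplies p q r P out" and len: "length P = mm_cost p q r"
    using mm_cost_attained by blast
  define run where "run = (\<lambda>X. slp_run X (\<lambda>_ _. 0) P [])"
  define val where "val = (\<lambda>l X. operand_val X (\<lambda>_ _. 0) (take l (run X)))"
  define F :: "mat_fun set" where "F = (\<lambda>m Z X. run X ! m) ` {..<length P}"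
  have "\<exists>d. (\<forall>l<length P. ((\<lambda>e. slp_run X (\<lambda>j' k'. e * of_bool (j' = j \<and> k' = k)) P [] ! l)
        has_real_derivative d l) (at 0)) \<and>
      (\<forall>l f a b. l < length P \<longrightarrow> P ! l = (f, a, b) \<longrightarrow>
       d l = fst (partials f (val l X a) (val l X b)) * tangent j k d l a
           + snd (partials f (val l X a) (val l X b)) * tangent j k d l b)" for X j k
    unfolding val_def run_def by (rule slp_tangents[of P X j k]) blast
  then obtain d where
    d_deriv: "\<And>X j k l. l < length P \<Longrightarrow>
      ((\<lambda>e. slp_run X (\<lambda>j' k'. e * of_bool (j' = j \<and> k' = k)) P [] ! l)
        has_real_derivative d X j k l) (at 0)" and
    d_step: "\<And>X j k l f a b. l < length P \<Longrightarrow> P ! l = (f, a, b) \<Longrightarrow>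
       d X j k l = fst (partials f (val l X a) (val l X b)) * tangent j k (d X j k) l a
           + snd (partials f (val l X a) (val l X b)) * tangent j k (d X j k) l b"
    by metis
  obtain idx where idx: "\<And>i k. i < p \<Longrightarrow> k < r \<Longrightarrow> idx i k < length P \<and> out i k = Res (idx i k)"
    using slp_multiplies_out[OF P q] by metis
  have idx_inj: "i = i' \<and> k = k'"
    if "i < p" "k < r" "i' < p" "k' < r" "idx i k = idx i' k'" for i k i' k'
    using slp_multiplies_inj[OF P q, of i k i' k'] idx that by metis
  \<comment> \<open>Along the unit direction at \<open>(j, k')\<close>, output \<open>(i, k)\<close>
    is the linear function with slope \<open>X i j\<close> if \<open>k = k'\<close>, and 0
    otherwise.\<close>
  have d_out: "d X j k' (idx i k) = X i j * of_bool (k' = k)"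
    if "i < p" "k < r" "j < q" for X i j k k'
  proof -
    have "(\<lambda>e. slp_run X (\<lambda>j' k''. e * of_bool (j' = j \<and> k'' = k')) P [] ! idx i k)
        = (\<lambda>e. \<Sum>j'<q. X i j' * (e * of_bool (j' = j \<and> k = k')))"
      using P idx[OF that(1,2)] that unfolding slp_multiplies_def by fastforce
    also have "\<dots> = (\<lambda>e. e * (X i j * of_bool (k' = k)))"
    proof
      fix e :: real
      have "(\<Sum>j'<q. X i j' * (e * of_bool (j' = j \<and> k = k')))
          = (\<Sum>j'<q. if j' = j then e * (X i j * of_bool (k' = k)) else 0)"
        by (intro sum.cong) auto
      then show "(\<Sum>j'<q. X i j' * (e * of_bool (j' = j \<and> k = k'))) = e * (X i j * of_bool (k' = k))"
        using that by simp
    qed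
    finally have "((\<lambda>e. e * (X i j * of_bool (k' = k))) has_real_derivative d X j k' (idx i k)) (at 0)"
      using d_deriv[of "idx i k" X j k'] idx[OF that(1,2)] by simp
    moreover have "((\<lambda>e. e * (X i j * of_bool (k' = k))) has_real_derivative
        X i j * of_bool (k' = k)) (at 0)"
      by (auto intro!: derivative_eq_intros)
    ultimately show ?thesis
      by (rule DERIV_unique)
  qed

  \<comment> \<open>The adjoint \<open>D a\<close> is the derivative of the weighted sum with respect to the operand
    \<open>a\<close>, taken with all results from number \<open>l\<close> on eliminated.\<close>
  define Phi where "Phi = (\<lambda>l (D :: operand \<Rightarrow> mat_fun) Z X j k.
      D (EntryY j k) Z X + (\<Sum>m<l. D (Res m) Z X * d X j k m) :: real)"
  \<comment> \<open>Where \<open>tangent\<close> vanishes identically (entries of X, constants,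
    results from \<open>l\<close> on), \<open>Phi l\<close> does not read the adjoint either, so the
    formula covers every operand.\<close>
  have Phi_upd: "Phi l (D(a := (\<lambda>Z X. D a Z X + g Z X * h Z X))) Z X j k
      = Phi l D Z X j k + g Z X * h Z X * tangent j k (d X j k) l a" for l D a g h Z X j k
  proof (cases a)
    case (Res m)
    have "(\<Sum>m'<l. (D(a := (\<lambda>Z X. D a Z X + g Z X * h Z X))) (Res m') Z X * d X j k m')
        = (\<Sum>m'<l. D (Res m') Z X * d X j k m' + (if m' = m then g Z X * h Z X * d X j k m else 0))"
      by (intro sum.cong) (auto simp: Res algebra_simps)
    then show ?thesis
      by (simp add: Phi_def Res sum.distrib)
  qed (auto simp: Phi_def)
  \<comment> \<open>Downward induction on \<open>l\<close>: eliminating result \<open>l\<close>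
    passes its adjoint on to its two operands, by one multiplication and one addition each, hence
    the factor 4. With the \<open>length P\<close> operations that recompute the results this gives
    5. At \<open>l = 0\<close> the sum is empty and only the adjoints of the entries of Y
    remain.\<close>
  have "\<exists>D. slp_computes (length P + 4 * (length P - l)) (range D \<union> F) \<and>
      (\<forall>Z X j k. j < q \<longrightarrow> k < r \<longrightarrow> Phi l D Z X j k = (\<Sum>i<p. Z k i * X i j))"
    if "l \<le> length P" for l
    using that
  proof (induction l rule: inc_induct)
    case base
    define A where "A = {..<p} \<times> {..<r}"
    \<comment> \<open>Initially the adjoint of output \<open>(i, k)\<close> is its weight
      \<open>Z k i\<close>, and all others are 0. Injectivity of \<open>idx\<close> makes the choice
      unambiguous.\<close>
    define D :: "operand \<Rightarrow> mat_fun" where "D = (\<lambda>a.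
      if \<exists>i<p. \<exists>k<r. a = Res (idx i k)
      then (let (i, k) = SOME (i, k). i < p \<and> k < r \<and> a = Res (idx i k) in (\<lambda>Z X. Z k i))
      else (\<lambda>Z X. 0))"
    have D_out: "D (Res (idx i k)) = (\<lambda>Z X. Z k i)" if "i < p" "k < r" for i k
    proof -
      have "(SOME (i', k'). i' < p \<and> k' < r \<and> Res (idx i k) = Res (idx i' k')) = (i, k)"
        by (rule some_equality) (use that idx_inj in auto)
      then show ?thesis
        using that unfolding D_def by auto
    qed
    have D_zero: "D a = (\<lambda>Z X. 0)" if "a \<notin> (\<lambda>(i, k). Res (idx i k)) ` A" for a
      using that by (auto simp: D_def A_def)
    have "D a \<in> inputs" for a
      by (cases "a \<in> (\<lambda>(i, k). Res (idx i k)) ` A")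
         (auto simp: A_def D_out D_zero)
    then have "slp_computes (length P) (range D \<union> F)"
      using slp_computes_inputs[OF slp_computes_results[of P]]
      by (rule_tac slp_computes_subset) (auto simp: F_def run_def)
    moreover have "Phi (length P) D Z X j k = (\<Sum>i<p. Z k i * X i j)" if "j < q" "k < r" for Z X j k
    proof -
      have inj: "inj_on (\<lambda>(i, k). idx i k) A"
        by (rule inj_onI) (use idx_inj in \<open>auto simp: A_def\<close>)
      have "(\<Sum>m<length P. D (Res m) Z X * d X j k m)
          = (\<Sum>m\<in>(\<lambda>(i, k). idx i k) ` A. D (Res m) Z X * d X j k m)"
      proof (rule sum.mono_neutral_right)
        have "D (Res m) = (\<lambda>Z X. 0)" if "m \<notin> (\<lambda>(i, k). idx i k) ` A" for m
          using that by (intro D_zero) auto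
        then show "\<forall>m\<in>{..<length P} - (\<lambda>(i, k). idx i k) ` A. D (Res m) Z X * d X j k m = 0"
          by simp
      qed (use idx in \<open>auto simp: A_def\<close>)
      also have "\<dots> = (\<Sum>(i, k')\<in>A. D (Res (idx i k')) Z X * d X j k (idx i k'))"
        by (subst sum.reindex[OF inj]) (auto intro!: sum.cong)
      also have "\<dots> = (\<Sum>(i, k')\<in>A. Z k' i * (X i j * of_bool (k = k')))"
        by (intro sum.cong) (auto simp: A_def D_out d_out \<open>j < q\<close>)
      also have "\<dots> = (\<Sum>i<p. \<Sum>k'<r. if k' = k then Z k i * X i j else 0)"
        unfolding A_def by (subst sum.cartesian_product[symmetric]) (intro sum.cong, auto)
      also have "\<dots> = (\<Sum>i<p. Z k i * X i j)"
        using \<open>k < r\<close> by simp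
      moreover have "D (EntryY j k) = (\<lambda>Z X. 0)"
        by (rule D_zero) auto
      ultimately show ?thesis
        by (simp add: Phi_def)
    qed
    ultimately show ?case
      by auto
  next
    case (step l)
    then obtain D where D: "slp_computes (length P + 4 * (length P - Suc l)) (range D \<union> F)"
      "\<And>Z X j k. j < q \<Longrightarrow> k < r \<Longrightarrow> Phi (Suc l) D Z X j k = (\<Sum>i<p. Z k i * X i j)"
      by blast
    obtain f a b where l: "P ! l = (f, a, b)"
      by (metis prod_cases3)
    define c1 :: mat_fun where "c1 = (\<lambda>Z X. fst (partials f (val l X a) (val l X b)))"
    define c2 :: mat_fun where "c2 = (\<lambda>Z X. snd (partials f (val l X a) (val l X b)))"
    \<comment> \<open>The partial derivatives are 1, -1 or operand values at \<open>Y = 0\<close>;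
      all are already available and cost nothing.\<close>
    have val: "(\<lambda>Z X. val l X a) \<in> F \<union> inputs" for a
    proof (cases a)
      case (Res m)
      then have "(\<lambda>Z X. val l X a) = (if m < l then (\<lambda>Z X. run X ! m) else (\<lambda>Z X. 0))"
        using \<open>l < length P\<close> by (auto simp: val_def run_def)
      then show ?thesis
        using \<open>l < length P\<close> by (cases "m < l") (auto simp: F_def)
    qed (auto simp: val_def)
    have const: "(\<lambda>Z X. c) \<in> inputs" for c
      by (auto simp: inputs_def)
    have c: "c1 \<in> F \<union> inputs" "c2 \<in> F \<union> inputs"
      using val[of a] val[of b] const by (cases f; simp add: c1_def c2_def)+
    define D1 where "D1 = D(a := (\<lambda>Z X. D a Z X + D (Res l) Z X * c1 Z X))"
    \<comment> \<open>Updating \<open>D1\<close> rather than \<open>D\<close> makes both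
      contributions count when the two operands coincide, as in a squaring.\<close>
    define D2 where "D2 = D1(b := (\<lambda>Z X. D1 b Z X + D (Res l) Z X * c2 Z X))"
    let ?s = "length P + 4 * (length P - Suc l)"
    have "slp_computes (?s + 2)
        (insert (\<lambda>Z X. D a Z X + D (Res l) Z X * c1 Z X) (range D \<union> F))"
      using D(1) by (rule slp_computes_muladd) (use c in auto)
    \<comment> \<open>The old adjoint of result \<open>l\<close> is kept explicitly: if
      \<open>a\<close> is the self-reference \<open>Res l\<close>, then \<open>D1\<close> has
      overwritten it.\<close>
    then have "slp_computes (?s + 2) (insert (D (Res l)) (range D1 \<union> F))"
      by (rule slp_computes_subset) (auto simp: D1_def)
    then have "slp_computes (?s + 2 + 2)
        (insert (\<lambda>Z X. D1 b Z X + D (Res l) Z X * c2 Z X) (insert (D (Res l)) (range D1 \<union> F)))"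
      by (rule slp_computes_muladd) (use c in auto)
    then have "slp_computes (?s + 2 + 2) (range D2 \<union> F)"
      by (rule slp_computes_subset) (auto simp: D2_def)
    also have "?s + 2 + 2 = length P + 4 * (length P - l)"
      using \<open>l < length P\<close> by simp
    finally have "slp_computes (length P + 4 * (length P - l)) (range D2 \<union> F)" .
    moreover have "Phi l D2 Z X j k = (\<Sum>i<p. Z k i * X i j)" if "j < q" "k < r" for Z X j k
    proof -
      have "Phi l D2 Z X j k = Phi l D Z X j k + D (Res l) Z X * d X j k l"
        unfolding D2_def Phi_upd unfolding D1_def Phi_upd
        using d_step[OF \<open>l < length P\<close> l, of X j k] by (simp add: c1_def c2_def algebra_simps)
      also have "\<dots> = Phi (Suc l) D Z X j k"
        by (simp add: Phi_def)
      finally show ?thesis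
        using D(2)[OF that] by simp
    qed
    ultimately show ?case
      by auto
  qed
  from this[of 0] obtain D where D: "slp_computes (5 * length P) (range D \<union> F)"
      "\<And>Z X j k. j < q \<Longrightarrow> k < r \<Longrightarrow> D (EntryY j k) Z X = (\<Sum>i<p. Z k i * X i j)"
    by (auto simp: Phi_def)
  then obtain Q where Q: "length Q \<le> 5 * length P"
      "\<And>c. \<exists>a. \<forall>Z X. operand_val Z X (slp_run Z X Q []) a = D c Z X"
    unfolding slp_computes_def by auto
  from Q(2) obtain out' where "\<And>c Z X. operand_val Z X (slp_run Z X Q []) (out' c) = D c Z X"
    by metis
  then have "slp_multiplies r p q Q (\<lambda>k j. out' (EntryY j k))"
    unfolding slp_multiplies_def using D(2) by simp
  then show ?thesis
    using mm_cost_le Q(1) len by (metis order_trans)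
qed

section \<open>Rounded powers and the exponent of matrix multiplication\<close>

lemma npow_1 [simp]: "npow n 1 = n"
  by (simp add: npow_def)

text \<open>In the reduction this yields \<open>t \<le> n\<close>, so that the selection matrix and
  \<open>V\<close> fit into square factors after padding with 0.\<close>

lemma npow_le: "n > 0 \<Longrightarrow> a \<le> 1 \<Longrightarrow> npow n a \<le> n"
  using powr_mono[of a 1 "real n"] unfolding npow_def
  by (simp add: nat_le_iff ceiling_le_iff)

lemma npow_ge: "real n powr a \<le> real (npow n a)"
  unfolding npow_def by linarith

lemma npow_pos: "n > 0 \<Longrightarrow> npow n a > 0"
  by (simp add: npow_def)

lemma npow_bigo:
  assumes "a \<ge> 0"
  shows "(\<lambda>n. real (npow n a)) \<in> O(\<lambda>n. real n powr a)"
proof (rule bigoI[of _ 2])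
  show "\<forall>\<^sub>F n in sequentially. norm (real (npow n a)) \<le> 2 * norm (real n powr a)"
  proof (rule eventually_mono[OF eventually_gt_at_top[of 0]])
    fix n :: nat
    assume "n > 0"
    then have "1 \<le> real n powr a"
      using assms by (simp add: ge_one_powr_ge_zero)
    then show "norm (real (npow n a)) \<le> 2 * norm (real n powr a)"
      unfolding npow_def by simp linarith
  qed
qed

lemma omega_rotate:
  assumes \<tau>: "0 < \<tau>" "\<tau> < 1"
  shows "omega 1 1 \<tau> \<le> omega 1 \<tau> 1" and "1 + \<tau> \<le> omega 1 1 \<tau>"
proof -
  define A where "A = {\<beta>. (\<lambda>n. real (mm_cost n (npow n \<tau>) n)) \<in> O(\<lambda>n. real n powr \<beta>)}"
  define B where "B = {\<beta>. (\<lambda>n. real (mm_cost n n (npow n \<tau>))) \<in> O(\<lambda>n. real n powr \<beta>)}"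
  \<comment> \<open>The real \<open>Inf\<close> is meaningful only for nonempty sets bounded below.
    The naive algorithm gives nonemptiness here, and the number of outputs gives the bound in
    \<open>lower\<close>.\<close>
  have "3 \<in> A"
  proof -
    have "\<forall>\<^sub>F n in sequentially.
        norm (real (mm_cost n (npow n \<tau>) n)) \<le> 2 * norm (real n powr 3)"
    proof (rule eventually_mono[OF eventually_gt_at_top[of 0]])
      fix n :: nat
      assume n: "n > 0"
      have "mm_cost n (npow n \<tau>) n \<le> 2 * n * npow n \<tau> * n"
        by (rule mm_cost_naive)
      also have "\<dots> \<le> 2 * n * n * n"
        using npow_le[OF n, of \<tau>] \<tau> by simp
      finally have "real (mm_cost n (npow n \<tau>) n) \<le> real (2 * n * n * n)"
        by (rule of_nat_mono)
      also have "\<dots> = 2 * (real n powr 3)"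
        using n by (simp add: powr_numeral power3_eq_cube)
      finally show "norm (real (mm_cost n (npow n \<tau>) n)) \<le> 2 * norm (real n powr 3)"
        by simp
    qed
    then show ?thesis
      unfolding A_def by (auto intro: bigoI)
  qed
  \<comment> \<open>Rotation with \<open>p = r = n\<close> and \<open>q = npow n \<tau>\<close>; the
    factor 5 vanishes in the asymptotics.\<close>
  have "A \<subseteq> B"
  proof -
    have "(\<lambda>n. real (mm_cost n n (npow n \<tau>))) \<in> O(\<lambda>n. real (mm_cost n (npow n \<tau>) n))"
    proof (rule bigoI[of _ 5], rule eventually_mono[OF eventually_gt_at_top[of 0]])
      fix n :: nat
      assume "n > 0"
      then have "mm_cost n n (npow n \<tau>) \<le> 5 * mm_cost n (npow n \<tau>) n"
        by (intro mm_cost_rotate npow_pos)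
      then have "real (mm_cost n n (npow n \<tau>)) \<le> real (5 * mm_cost n (npow n \<tau>) n)"
        by (rule of_nat_mono)
      then show "norm (real (mm_cost n n (npow n \<tau>))) \<le> 5 * norm (real (mm_cost n (npow n \<tau>) n))"
        by simp
    qed
    then show ?thesis
      unfolding A_def B_def using landau_o.big_trans by blast
  qed
  have lower: "1 + \<tau> \<le> \<beta>" if "\<beta> \<in> B" for \<beta>
  proof -
    have "(\<lambda>n. real n powr (1 + \<tau>)) \<in> O(\<lambda>n. real (mm_cost n n (npow n \<tau>)))"
    proof (rule bigoI[of _ 1], rule eventually_mono[OF eventually_gt_at_top[of 0]])
      fix n :: nat
      assume n: "n > 0"
      have "real n powr (1 + \<tau>) = real n * real n powr \<tau>"
        using n by (simp add: powr_add)
      also have "\<dots> \<le> real n * real (npow n \<tau>)"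
        by (intro mult_left_mono npow_ge) simp
      also have "\<dots> \<le> real (mm_cost n n (npow n \<tau>))"
        using mm_cost_ge[OF n, of n "npow n \<tau>"] by (metis of_nat_mono of_nat_mult)
      finally show "norm (real n powr (1 + \<tau>)) \<le> 1 * norm (real (mm_cost n n (npow n \<tau>)))"
        by simp
    qed
    then have "(\<lambda>n. real n powr (1 + \<tau>)) \<in> O(\<lambda>n. real n powr \<beta>)"
      using that landau_o.big_trans unfolding B_def by blast
    then show ?thesis
      by (simp add: powr_bigo_iff filterlim_real_sequentially)
  qed
  have omega: "omega 1 \<tau> 1 = Inf A" "omega 1 1 \<tau> = Inf B"
    by (simp_all add: omega_def A_def B_def)
  have "bdd_below B"
    using lower by (auto simp: bdd_below_def)
  then show "omega 1 1 \<tau> \<le> omega 1 \<tau> 1"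
    unfolding omega using \<open>3 \<in> A\<close> \<open>A \<subseteq> B\<close> by (intro cInf_superset_mono) auto
  show "1 + \<tau> \<le> omega 1 1 \<tau>"
    unfolding omega using \<open>3 \<in> A\<close> \<open>A \<subseteq> B\<close> lower by (intro cInf_greatest) auto
qed

section \<open>Simulation on the word RAM\<close>

lemma exec_word_mono: "exec W c s T s' \<Longrightarrow> W \<le> W' \<Longrightarrow> exec W' c s T s'"
proof (induction rule: exec.induct)
  case (Seq c s T s' d T' s'')
  then show ?case
    by (blast intro: exec.Seq)
next
  case (WhileTrue s x c T s' T' s'')
  then show ?case
    by (blast intro: exec.WhileTrue)
qed (rule exec.intros; simp)+

inductive_cases exec_elims:
  "exec W Skip s T s'" "exec W (Const r v) s T s'" "exec W (Op r f x y) s T s'"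
  "exec W (Load r a x) s T s'" "exec W (Store a x y) s T s'" "exec W (Seq c d) s T s'"
  "exec W (If x c d) s T s'"
inductive_cases exec_WhileE: "exec W (While x c) s T s'"

lemma exec_deterministic: "exec W c s T s' \<Longrightarrow> exec W c s T2 s2 \<Longrightarrow> T2 = T \<and> s2 = s'"
proof (induction arbitrary: T2 s2 rule: exec.induct)
  case (Seq c s T s' d T' s'')
  obtain T1 s1 T1' where "T2 = T1 + T1'" "exec W c s T1 s1" "exec W d s1 T1' s2"
    using Seq.prems by (rule exec_elims(6))
  then show ?case
    using Seq.IH(1)[of T1 s1] Seq.IH(2)[of T1' s2] by simp
next
  case (IfTrue s x c T s' d)
  obtain T1 where "T2 = Suc T1" "exec W c s T1 s2"
    using IfTrue.prems by (rule exec_elims(7)) (use IfTrue.hyps in auto)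
  then show ?case
    using IfTrue.IH[of T1 s2] by simp
next
  case (IfFalse s x d T s' c)
  obtain T1 where "T2 = Suc T1" "exec W d s T1 s2"
    using IfFalse.prems by (rule exec_elims(7)) (use IfFalse.hyps in auto)
  then show ?case
    using IfFalse.IH[of T1 s2] by simp
next
  case (WhileFalse s x c)
  from WhileFalse.prems show ?case
    by (rule exec_WhileE) (use WhileFalse.hyps in auto)
next
  case (WhileTrue s x c T s' T' s'')
  obtain T1 s1 T1' where "T2 = Suc (T1 + T1')" "exec W c s T1 s1" "exec W (While x c) s1 T1' s2"
    using WhileTrue.prems by (rule exec_WhileE) (use WhileTrue.hyps in auto)
  then show ?case
    using WhileTrue.IH(1)[of T1 s1] WhileTrue.IH(2)[of T1' s2] by simp
qed (erule exec_elims; simp)+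

primrec rename_com :: "(nat \<Rightarrow> nat) \<Rightarrow> (nat \<Rightarrow> nat) \<Rightarrow> com \<Rightarrow> com" where
  "rename_com \<rho> \<sigma> Skip = Skip"
| "rename_com \<rho> \<sigma> (Const r v) = Const (\<rho> r) v"
| "rename_com \<rho> \<sigma> (Op r f x y) = Op (\<rho> r) f (\<rho> x) (\<rho> y)"
| "rename_com \<rho> \<sigma> (Load r a x) = Load (\<rho> r) (\<sigma> a) (\<rho> x)"
| "rename_com \<rho> \<sigma> (Store a x y) = Store (\<sigma> a) (\<rho> x) (\<rho> y)"
| "rename_com \<rho> \<sigma> (Seq c d) = Seq (rename_com \<rho> \<sigma> c) (rename_com \<rho> \<sigma> d)"
| "rename_com \<rho> \<sigma> (If x c d) = If (\<rho> x) (rename_com \<rho> \<sigma> c) (rename_com \<rho> \<sigma> d)"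
| "rename_com \<rho> \<sigma> (While x c) = While (\<rho> x) (rename_com \<rho> \<sigma> c)"

definition embedded :: "(nat \<Rightarrow> nat) \<Rightarrow> (nat \<Rightarrow> nat) \<Rightarrow> state \<Rightarrow> state \<Rightarrow> bool" where
  "embedded \<rho> \<sigma> s S \<longleftrightarrow> (\<forall>r. reg S (\<rho> r) = reg s r) \<and> (\<forall>a. arr S (\<sigma> a) = arr s a)"

definition same_outside :: "(nat \<Rightarrow> nat) \<Rightarrow> (nat \<Rightarrow> nat) \<Rightarrow> state \<Rightarrow> state \<Rightarrow> bool" where
  "same_outside \<rho> \<sigma> S S' \<longleftrightarrow>
     (\<forall>r. r \<notin> range \<rho> \<longrightarrow> reg S' r = reg S r) \<and> (\<forall>a. a \<notin> range \<sigma> \<longrightarrow> arr S' a = arr S a)"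

lemma set_simps [simp]:
  "reg (set_reg r v s) = (reg s)(r := v)" "arr (set_reg r v s) = arr s"
  "reg (set_arr a i v s) = reg s" "arr (set_arr a i v s) = (arr s)(a := (arr s a)(i := v))"
  by (auto simp: set_reg_def set_arr_def)

text \<open>Injectivity keeps a write to one renamed cell from disturbing another.
  \<open>same_outside\<close> is what lets the data of the surrounding code survive, and the running
  time is unchanged.\<close>

lemma exec_rename:
  assumes "exec W c s T s'" "embedded \<rho> \<sigma> s S" and inj: "inj \<rho>" "inj \<sigma>"
  shows "\<exists>S'. exec W (rename_com \<rho> \<sigma> c) S T S' \<and> embedded \<rho> \<sigma> s' S' \<and> same_outside \<rho> \<sigma> S S'"
  using assms(1,2)
proof (induction arbitrary: S rule: exec.induct)
  case (Skip s)
  have "same_outside \<rho> \<sigma> S S"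
    by (simp add: same_outside_def)
  then show ?case
    using Skip exec.Skip by fastforce
next
  case (Const v r s)
  have "exec W (Const (\<rho> r) v) S 1 (set_reg (\<rho> r) v S)"
    using Const by (intro exec.Const)
  moreover have "embedded \<rho> \<sigma> (set_reg r v s) (set_reg (\<rho> r) v S)"
    using Const inj by (simp add: embedded_def inj_eq)
  moreover have "same_outside \<rho> \<sigma> S (set_reg (\<rho> r) v S)"
    by (auto simp: same_outside_def)
  ultimately show ?case
    unfolding rename_com.simps by blast
next
  case (Op f s x y r)
  let ?v = "binop_val f (reg s x) (reg s y)"
  have "exec W (Op (\<rho> r) f (\<rho> x) (\<rho> y)) S 1 (set_reg (\<rho> r) ?v S)"
    using exec.Op[of f S "\<rho> x" "\<rho> y" W "\<rho> r"] Op by (simp add: embedded_def)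
  moreover have "embedded \<rho> \<sigma> (set_reg r ?v s) (set_reg (\<rho> r) ?v S)"
    using Op inj by (simp add: embedded_def inj_eq)
  moreover have "same_outside \<rho> \<sigma> S (set_reg (\<rho> r) ?v S)"
    by (auto simp: same_outside_def)
  ultimately show ?case
    unfolding rename_com.simps by blast
next
  case (Load r a x s)
  let ?v = "arr s a (reg s x)"
  have "exec W (Load (\<rho> r) (\<sigma> a) (\<rho> x)) S 1 (set_reg (\<rho> r) ?v S)"
    using exec.Load[of W "\<rho> r" "\<sigma> a" "\<rho> x" S] Load by (simp add: embedded_def)
  moreover have "embedded \<rho> \<sigma> (set_reg r ?v s) (set_reg (\<rho> r) ?v S)"
    using Load inj by (simp add: embedded_def inj_eq)
  moreover have "same_outside \<rho> \<sigma> S (set_reg (\<rho> r) ?v S)"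
    by (auto simp: same_outside_def)
  ultimately show ?case
    unfolding rename_com.simps by blast
next
  case (Store a x y s)
  let ?S = "set_arr (\<sigma> a) (reg s x) (reg s y) S"
  have "exec W (Store (\<sigma> a) (\<rho> x) (\<rho> y)) S 1 ?S"
    using exec.Store[of W "\<sigma> a" "\<rho> x" "\<rho> y" S] Store by (simp add: embedded_def)
  moreover have "embedded \<rho> \<sigma> (set_arr a (reg s x) (reg s y) s) ?S"
    using Store inj by (simp add: embedded_def inj_eq)
  moreover have "same_outside \<rho> \<sigma> S ?S"
    by (auto simp: same_outside_def)
  ultimately show ?case
    unfolding rename_com.simps by blast
next
  case (Seq c s T s' d T' s'')
  obtain S' where S': "exec W (rename_com \<rho> \<sigma> c) S T S'" "embedded \<rho> \<sigma> s' S'"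
      "same_outside \<rho> \<sigma> S S'"
    using Seq.IH(1)[OF Seq.prems] by blast
  obtain S'' where S'': "exec W (rename_com \<rho> \<sigma> d) S' T' S''" "embedded \<rho> \<sigma> s'' S''"
      "same_outside \<rho> \<sigma> S' S''"
    using Seq.IH(2)[OF S'(2)] by blast
  have "same_outside \<rho> \<sigma> S S''"
    using S'(3) S''(3) by (simp add: same_outside_def)
  then show ?case
    using exec.Seq[OF S'(1) S''(1)] S''(2) unfolding rename_com.simps by blast
next
  case (IfTrue s x c T s' d)
  obtain S' where "exec W (rename_com \<rho> \<sigma> c) S T S'" "embedded \<rho> \<sigma> s' S'" "same_outside \<rho> \<sigma> S S'"
    using IfTrue.IH[OF IfTrue.prems] by blast
  moreover have "reg S (\<rho> x) \<noteq> 0"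
    using IfTrue by (simp add: embedded_def)
  ultimately show ?case
    unfolding rename_com.simps by (blast intro: exec.IfTrue)
next
  case (IfFalse s x d T s' c)
  obtain S' where "exec W (rename_com \<rho> \<sigma> d) S T S'" "embedded \<rho> \<sigma> s' S'" "same_outside \<rho> \<sigma> S S'"
    using IfFalse.IH[OF IfFalse.prems] by blast
  moreover have "reg S (\<rho> x) = 0"
    using IfFalse by (simp add: embedded_def)
  ultimately show ?case
    unfolding rename_com.simps by (blast intro: exec.IfFalse)
next
  case (WhileFalse s x c)
  have "same_outside \<rho> \<sigma> S S" "reg S (\<rho> x) = 0"
    using WhileFalse by (simp_all add: same_outside_def embedded_def)
  then show ?case
    using WhileFalse.prems unfolding rename_com.simps by (blast intro: exec.WhileFalse)
next
  case (WhileTrue s x c T s' T' s'')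
  obtain S' where S': "exec W (rename_com \<rho> \<sigma> c) S T S'" "embedded \<rho> \<sigma> s' S'"
      "same_outside \<rho> \<sigma> S S'"
    using WhileTrue.IH(1)[OF WhileTrue.prems] by blast
  obtain S'' where S'': "exec W (While (\<rho> x) (rename_com \<rho> \<sigma> c)) S' T' S''"
      "embedded \<rho> \<sigma> s'' S''" "same_outside \<rho> \<sigma> S' S''"
    using WhileTrue.IH(2)[OF S'(2)] unfolding rename_com.simps by blast
  have "same_outside \<rho> \<sigma> S S''"
    using S'(3) S''(3) by (simp add: same_outside_def)
  moreover have "reg S (\<rho> x) \<noteq> 0"
    using WhileTrue by (simp add: embedded_def)
  ultimately show ?case
    using exec.WhileTrue[OF _ S'(1) S''(1)] S''(2) unfolding rename_com.simps by blast
qed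

section \<open>Total correctness with time bounds\<close>

definition runs :: "nat \<Rightarrow> com \<Rightarrow> state \<Rightarrow> nat \<Rightarrow> (state \<Rightarrow> bool) \<Rightarrow> bool" where
  "runs W c s B Q \<longleftrightarrow> (\<exists>T s'. exec W c s T s' \<and> T \<le> B \<and> Q s')"

lemma runs_atomic:
  "v < W \<Longrightarrow> Q (set_reg r v s) \<Longrightarrow> runs W (Const r v) s 1 Q"
  "binop_val f (reg s x) (reg s y) < W \<Longrightarrow>
     Q (set_reg r (binop_val f (reg s x) (reg s y)) s) \<Longrightarrow> runs W (Op r f x y) s 1 Q"
  "Q (set_reg r (arr s a (reg s x)) s) \<Longrightarrow> runs W (Load r a x) s 1 Q"
  "Q (set_arr a (reg s x) (reg s y) s) \<Longrightarrow> runs W (Store a x y) s 1 Q"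
  unfolding runs_def by (blast intro: exec.intros)+

lemma runs_Seq:
  "runs W c s B (\<lambda>s'. runs W d s' B' Q) \<Longrightarrow> runs W (Seq c d) s (B + B') Q"
  unfolding runs_def by (blast intro: exec.Seq add_mono)

lemma runs_weaken: "runs W c s B Q \<Longrightarrow> B \<le> B' \<Longrightarrow> (\<And>s'. Q s' \<Longrightarrow> R s') \<Longrightarrow> runs W c s B' R"
  unfolding runs_def by (meson order_trans)

text \<open>The index of the invariant is the loop register itself. Each round pays the body and one
  test, and the final 1 is the failing test.\<close>

lemma runs_countdown:
  assumes body: "\<And>k s. I (Suc k) s \<Longrightarrow> runs W c s B (I k)"
    and x: "\<And>k s. I k s \<Longrightarrow> reg s x = k"
    and "I m s"
  shows "runs W (While x c) s (m * Suc B + 1) (I 0)"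
  using \<open>I m s\<close>
proof (induction m arbitrary: s)
  case 0
  then show ?case
    using x[OF 0] exec.WhileFalse[of s x W c] unfolding runs_def by fastforce
next
  case (Suc m)
  obtain T s' where 1: "exec W c s T s'" "T \<le> B" "I m s'"
    using body[OF Suc.prems] unfolding runs_def by blast
  obtain T' s'' where 2: "exec W (While x c) s' T' s''" "T' \<le> m * Suc B + 1" "I 0 s''"
    using Suc.IH[OF 1(3)] unfolding runs_def by blast
  have "exec W (While x c) s (T + T' + 1) s''"
    using x[OF Suc.prems] 1 2 by (intro exec.WhileTrue) auto
  moreover have "T + T' + 1 \<le> Suc m * Suc B + 1"
    using 1 2 by simp
  ultimately show ?case
    using 2 unfolding runs_def by blast
qed

lemma runs_rename:
  assumes "exec W c s T s'" "W \<le> W'" "T \<le> B" "embedded \<rho> \<sigma> s S" "inj \<rho>" "inj \<sigma>"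
    and "\<And>S'. embedded \<rho> \<sigma> s' S' \<Longrightarrow> same_outside \<rho> \<sigma> S S' \<Longrightarrow> Q S'"
  shows "runs W' (rename_com \<rho> \<sigma> c) S B Q"
  using exec_rename[OF exec_word_mono[OF assms(1,2)] assms(4-6)] assms(3,7)
  unfolding runs_def by blast

section \<open>The reduction\<close>

definition serves_all ::
  "query_kind \<Rightarrow> nat \<Rightarrow> com \<Rightarrow> com \<Rightarrow> (nat \<Rightarrow> nat) \<Rightarrow> (nat \<Rightarrow> nat) \<Rightarrow> nat \<Rightarrow> nat \<Rightarrow>
   (nat \<Rightarrow> bmat) \<Rightarrow> state \<Rightarrow> bool" where
  "serves_all knd e U Q u q n k M s \<longleftrightarrow>
     (\<forall>rs. list_all (valid_request n) rs \<longrightarrow> serves knd e U Q u q n k M s rs)"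

text \<open>Determinism makes the state after an update independent of the requests that follow.\<close>

lemma serves_all_Update:
  assumes s: "serves_all knd e U Q u q n k M s" and valid: "valid_request n (Update m i j b)"
  shows "\<exists>T s'. exec (word_bound e (n + k)) U (give_update m i j b s) T s' \<and> T \<le> u n \<and>
    serves_all knd e U Q u q n (Suc k) (set_entry m i j b M) s'"
proof -
  let ?E = "exec (word_bound e (n + k)) U (give_update m i j b s)"
  have *: "\<exists>T s'. ?E T s' \<and> T \<le> u n \<and> serves knd e U Q u q n (Suc k) (set_entry m i j b M) s' rs"
    if "list_all (valid_request n) rs" for rs
  proof -
    have "list_all (valid_request n) (Update m i j b # rs)"
      using valid that by simp
    then have "serves knd e U Q u q n k M s (Update m i j b # rs)"
      using s unfolding serves_all_def by blast
    then show ?thesis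
      by simp
  qed
  obtain T s' where s': "?E T s'" "T \<le> u n"
    using *[of "[]"] by auto
  have "serves_all knd e U Q u q n (Suc k) (set_entry m i j b M) s'"
    unfolding serves_all_def using * exec_deterministic[OF s'(1)] by blast
  then show ?thesis
    using s' by blast
qed

lemma serves_all_Query:
  assumes "serves_all knd e U Q u q n k M s" "j < n"
  shows "\<exists>T s'. exec (word_bound e (n + k)) Q (set_reg 1 j s) T s' \<and> T \<le> q n \<and>
    outputs n (answer knd (triple_product n M) j) s'"
  using assms unfolding serves_all_def by (auto dest: spec[of _ "[Query j]"])

text \<open>The guards by \<open>t\<close> erase the values of the function \<open>V\<close> outside
  its \<open>t\<close> rows. For row queries the factors multiply to V^T S^T N^T, whose rows are the
  columns of NSV.\<close>

fun factors :: "query_kind \<Rightarrow> nat \<Rightarrow> bmat \<Rightarrow> bmat \<Rightarrow> bmat \<Rightarrow> nat \<Rightarrow> bmat" where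
  "factors ColumnQuery t N V S =
     (\<lambda>m. if m = 0 then N else if m = 1 then S else (\<lambda>i j. i < t \<and> V i j))"
| "factors RowQuery t N V S =
     (\<lambda>m. if m = 0 then (\<lambda>i j. j < t \<and> V j i) else if m = 1 then (\<lambda>i j. S j i) else (\<lambda>i j. N j i))"

text \<open>The parameter \<open>k\<close> describes a partially inserted selection matrix: the loop
  counts down, so the columns from \<open>k\<close> on are in place.\<close>

definition selection :: "nat \<Rightarrow> (nat \<Rightarrow> nat) \<Rightarrow> nat \<Rightarrow> bmat" where
  "selection t I k = (\<lambda>i j. k \<le> j \<and> j < t \<and> i = I j)"

lemma answer_factors:
  assumes "\<forall>k<t. I k < n" "t \<le> n"
  shows "answer knd (triple_product n (factors knd t N V (selection t I 0))) j
    = bmult_vec t (select_cols N I) (column V j)"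
proof
  fix i
  have le: "k < n" if "k < t" for k
    using that \<open>t \<le> n\<close> by simp
  show "answer knd (triple_product n (factors knd t N V (selection t I 0))) j i
      = bmult_vec t (select_cols N I) (column V j) i"
  proof (cases knd)
    case ColumnQuery
    then show ?thesis
      using assms(1) le by (simp add: column_def triple_product_def bmult_def selection_def
          bmult_vec_def select_cols_def) blast
  next
    case RowQuery
    then show ?thesis
      using assms(1) le by (simp add: row_def column_def triple_product_def bmult_def selection_def
          bmult_vec_def select_cols_def) blast
  qed
qed

text \<open>Besides coordinates it is applied to 12 and 13, the renamed registers 2 and 3 in which
  an update expects its row and column.\<close>

fun pos :: "query_kind \<Rightarrow> nat \<Rightarrow> nat \<Rightarrow> nat \<times> nat" where
  "pos ColumnQuery i j = (i, j)"
| "pos RowQuery i j = (j, i)"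

lemma set_entry_factors:
  assumes "k < t"
  shows "set_entry 1 (fst (pos knd (I k) k)) (snd (pos knd (I k) k)) True
      (factors knd t N V (selection t I (Suc k))) = factors knd t N V (selection t I k)"
  using assms by (cases knd) (auto simp: set_entry_def selection_def fun_eq_iff Suc_le_eq le_less)

text \<open>Register 0 holds \<open>n\<close> in both problems and is shared; the shift by 10 leaves
  registers 1 to 10 to the surrounding code.\<close>

definition reg_map :: "nat \<Rightarrow> nat" where
  "reg_map r = (if r = 0 then 0 else r + 10)"

text \<open>
  For column queries the arrays of the hinted problem already are the first and third factor.
\<close>

fun arr_map :: "query_kind \<Rightarrow> nat \<Rightarrow> nat" where
  "arr_map ColumnQuery a = (if a = 0 then 0 else if a = 2 then 1 else if a = 3 then 3 else a + 10)"
| "arr_map RowQuery a = (if a = 3 then 3 else a + 10)"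

lemma embedded_reg_map:
  "embedded reg_map \<sigma> s S \<longleftrightarrow>
     reg S 0 = reg s 0 \<and> (\<forall>r>0. reg S (r + 10) = reg s r) \<and> (\<forall>a. arr S (\<sigma> a) = arr s a)"
  by (auto simp: embedded_def reg_map_def)

lemma inj_reg_map: "inj reg_map"
  by (auto simp: inj_def reg_map_def)

lemma inj_arr_map: "inj (arr_map knd)"
  by (cases knd) (auto simp: inj_def)

text \<open>This protects the loop registers and array 2, where \<open>I\<close> is stored, from the
  simulated programs.\<close>

lemma not_in_range [simp]: "0 < r \<Longrightarrow> r \<le> 10 \<Longrightarrow> r \<notin> range reg_map" "2 \<notin> range (arr_map knd)"
  by (auto simp: reg_map_def split: if_splits) (cases knd; auto split: if_splits)

lemma arr_map_neq_2 [simp]: "arr_map knd a \<noteq> 2"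
  using not_in_range(2)[of knd] by (metis rangeI)

text \<open>The row case writes the transposes of \<open>V\<close> and \<open>N\<close> to arrays 10
  and 12, the images of 0 and 2. Cells of array 1 beyond the \<open>t\<close> rows of
  \<open>V\<close> read 0, so padding is automatic.\<close>

fun prelude :: "query_kind \<Rightarrow> com" where
  "prelude ColumnQuery = Skip"
| "prelude RowQuery =
     Seq (Const 4 1) (Seq (Op 3 Mul 0 0) (While 3
       (Seq (Op 3 Sub 3 4) (Seq (Op 6 Div 3 0) (Seq (Op 7 Mod 3 0) (Seq (Op 7 Mul 7 0)
       (Seq (Op 6 Add 7 6) (Seq (Load 7 1 6) (Seq (Store 10 3 7) (Seq (Load 7 0 6)
            (Store 12 3 7)))))))))))"

text \<open>Registers 11 to 14 are the renamed update parameters: factor 1, the position, the bit 1.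
  Adding register 5, which stays 0, serves as a move, here and in
  \<open>query_column\<close>.\<close>

definition insert_selection :: "query_kind \<Rightarrow> com \<Rightarrow> com" where
  "insert_selection knd U =
     Seq (Const 4 1) (While 1
       (Seq (Op 1 Sub 1 4) (Seq (Load (fst (pos knd 12 13)) 2 1)
       (Seq (Op (snd (pos knd 12 13)) Add 1 5) (Seq (Const 11 1) (Seq (Const 14 1)
            (rename_com reg_map (arr_map knd) U)))))))"

definition query_column :: "query_kind \<Rightarrow> com \<Rightarrow> com" where
  "query_column knd Q = Seq (Op 11 Add 2 5) (rename_com reg_map (arr_map knd) Q)"

lemma transposed_index:
  fixes a n :: nat
  assumes "a < n * n"
  shows "a div n < n" "(a mod n * n + a div n) div n = a mod n" "(a mod n * n + a div n) mod n = a div n"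
    "a mod n * n + a div n < n * n" "a mod n * n + a div n < t * n \<longleftrightarrow> a mod n < t"
proof -
  have n: "n > 0"
    using assms by (cases n) auto
  show "a div n < n"
    using assms by (simp add: less_mult_imp_div_less)
  then show d: "(a mod n * n + a div n) div n = a mod n"
    and "(a mod n * n + a div n) mod n = a div n"
    by simp_all
  show *: "a mod n * n + a div n < t * n \<longleftrightarrow> a mod n < t" for t
    using div_less_iff_less_mult[OF n, of "a mod n * n + a div n" t] d by simp
  show "a mod n * n + a div n < n * n"
    using *[of n] n by simp
qed

lemma runs_prelude:
  assumes W: "n * n < W" "n < W" "1 < W" and "t \<le> n"
  shows "runs W (prelude knd) (hint_start n t N V) (10 * (n * n) + 3)
    (\<lambda>S. reg S 1 = t \<and> reg S 5 = 0 \<and>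
       embedded reg_map (arr_map knd) (dyn_start n (factors knd t N V (\<lambda>_ _. False))) S)"
proof (cases knd)
  case ColumnQuery
  \<comment> \<open>Both encodings have rows of width \<open>n\<close>, so appending zero rows
    leaves the array unchanged.\<close>
  have "encode_mat t n V = encode_mat n n (\<lambda>i j. i < t \<and> V i j)"
  proof
    fix a
    show "encode_mat t n V a = encode_mat n n (\<lambda>i j. i < t \<and> V i j) a"
    proof (cases "n = 0")
      case False
      then have "a < t * n \<longleftrightarrow> a div n < t"
        by (simp add: div_less_iff_less_mult)
      moreover have "a < n * n" if "a < t * n"
        using that mult_le_mono1[OF \<open>t \<le> n\<close>, of n] by linarith
      ultimately show ?thesis
        by (auto simp: encode_mat_def)
    qed (simp add: encode_mat_def)
  qed
  then have "embedded reg_map (arr_map ColumnQuery)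
      (dyn_start n (factors ColumnQuery t N V (\<lambda>_ _. False))) (hint_start n t N V)"
    by (auto simp: embedded_def dyn_start_def hint_start_def blank_def reg_map_def encode_mat_def)
  moreover have "reg (hint_start n t N V) 1 = t" "reg (hint_start n t N V) 5 = 0"
    by (simp_all add: hint_start_def)
  ultimately have "runs W Skip (hint_start n t N V) 1
    (\<lambda>S. reg S 1 = t \<and> reg S 5 = 0 \<and>
       embedded reg_map (arr_map ColumnQuery) (dyn_start n (factors ColumnQuery t N V (\<lambda>_ _. False))) S)"
    unfolding runs_def using exec.Skip by blast
  then show ?thesis
    unfolding ColumnQuery prelude.simps by (rule runs_weaken) auto
next
  case RowQuery
  define A where "A = encode_mat n n (\<lambda>i j. j < t \<and> V j i)"
  define C where "C = encode_mat n n (\<lambda>i j. N j i)"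
  have AC: "A a = encode_mat t n V (a mod n * n + a div n)"
    "C a = encode_mat n n N (a mod n * n + a div n)" if "a < n * n" for a
    using that by (auto simp: A_def C_def encode_mat_def transposed_index)
  \<comment> \<open>Cells from \<open>k\<close> on are transposed, lower ones are still 0. Registers
    above 10 must stay 0, being the blank registers of the simulated program.\<close>
  define Inv where "Inv = (\<lambda>k (S :: state). k \<le> n * n \<and> reg S 3 = k \<and> reg S 0 = n \<and> reg S 1 = t \<and> reg S 4 = 1
    \<and> reg S 5 = 0 \<and> (\<forall>r>10. reg S r = 0) \<and> arr S 0 = encode_mat n n N \<and> arr S 1 = encode_mat t n V
    \<and> (\<forall>a. arr S 10 a = (if k \<le> a then A a else 0)) \<and> (\<forall>a. arr S 12 a = (if k \<le> a then C a else 0))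
    \<and> (\<forall>x. x \<notin> {0, 1, 10, 12} \<longrightarrow> arr S x = (\<lambda>_. 0)))"
  let ?body = "Seq (Op 3 Sub 3 4) (Seq (Op 6 Div 3 0) (Seq (Op 7 Mod 3 0) (Seq (Op 7 Mul 7 0)
       (Seq (Op 6 Add 7 6) (Seq (Load 7 1 6) (Seq (Store 10 3 7) (Seq (Load 7 0 6)
            (Store 12 3 7))))))))"
  have body: "runs W ?body S (1 + (1 + (1 + (1 + (1 + (1 + (1 + (1 + 1)))))))) (Inv k)"
    if "Inv (Suc k) S" for k S
  proof -
    have S: "k < n * n" "reg S 3 = Suc k" "reg S 0 = n" "reg S (Suc 0) = t" "reg S 4 = 1"
      "reg S 5 = 0" "\<And>r. 10 < r \<Longrightarrow> reg S r = 0" "arr S 0 = encode_mat n n N"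
      "arr S (Suc 0) = encode_mat t n V" "\<And>a. arr S 10 a = (if Suc k \<le> a then A a else 0)"
      "\<And>a. arr S 12 a = (if Suc k \<le> a then C a else 0)"
      "\<And>x. x \<notin> {0, 1, 10, 12} \<Longrightarrow> arr S x = (\<lambda>_. 0)"
      using that by (auto simp: Inv_def)
    have "k div n \<le> k"
      by simp
    moreover have "k mod n * n + k div n < n * n"
      by (rule transposed_index(4)) (rule S)
    ultimately have "k < W" "k div n < W" "k mod n < W" "k mod n * n < W" "k mod n * n + k div n < W"
      using W S(1) mod_less_eq_dividend[of k n] by linarith+
    then show ?thesis
      by (intro runs_Seq runs_atomic)
        (simp_all add: S Inv_def AC[OF S(1)] le_less Suc_le_eq less_imp_le)
  qed
  have start: "Inv (n * n) (set_reg 3 (n * n) (set_reg 4 1 (hint_start n t N V)))"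
    by (auto simp: Inv_def hint_start_def blank_def A_def C_def encode_mat_def)
  have "runs W (While 3 ?body) (set_reg 3 (n * n) (set_reg 4 1 (hint_start n t N V)))
      (n * n * Suc (1 + (1 + (1 + (1 + (1 + (1 + (1 + (1 + 1)))))))) + 1) (Inv 0)"
    by (rule runs_countdown[where I = Inv, OF body _ start]) (auto simp: Inv_def)
  moreover have "reg (hint_start n t N V) 0 = n"
    by (simp add: hint_start_def)
  ultimately have "runs W (prelude RowQuery) (hint_start n t N V)
      (1 + (1 + (n * n * Suc (1 + (1 + (1 + (1 + (1 + (1 + (1 + (1 + 1)))))))) + 1))) (Inv 0)"
    unfolding prelude.simps using W by (intro runs_Seq runs_atomic) simp_all
  moreover have "embedded reg_map (arr_map RowQuery)
      (dyn_start n (factors RowQuery t N V (\<lambda>_ _. False))) S" if "Inv 0 S" for S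
  proof -
    have *: "arr S 10 = A" "arr S 12 = C" "reg S 0 = n" "\<And>r. 10 < r \<Longrightarrow> reg S r = 0"
      "\<And>x. x \<notin> {0, 1, 10, 12} \<Longrightarrow> arr S x = (\<lambda>_. 0)"
      using that by (auto simp: Inv_def fun_eq_iff)
    have "arr S (arr_map RowQuery x) = arr (dyn_start n (factors RowQuery t N V (\<lambda>_ _. False))) x" for x
    proof -
      consider "x = 0" | "x = 1" | "x = 2" | "x = 3" | "x > 3"
        by linarith
      then show ?thesis
        by cases (simp_all add: * dyn_start_def A_def C_def encode_mat_def)
    qed
    then show ?thesis
      by (auto simp: embedded_def reg_map_def dyn_start_def blank_def *)
  qed
  ultimately show ?thesis
    unfolding RowQuery by (elim runs_weaken) (auto simp: Inv_def)
qed

lemma embedded_update: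
  assumes "embedded reg_map \<sigma> s S"
  shows "embedded reg_map \<sigma> (give_update 1 (fst (pos knd i k)) (snd (pos knd i k)) True s)
    (set_reg 14 1 (set_reg 11 1 (set_reg (snd (pos knd 12 13)) k
      (set_reg (fst (pos knd 12 13)) i (set_reg 1 k S)))))"
  using assms by (cases knd) (auto simp: embedded_reg_map give_update_def)

text \<open>For \<open>k \<le> n\<close> the base at most squares, which doubles the exponent; the
  extra 2 makes room for the counter \<open>n * n\<close> of the prelude, even if
  \<open>e = 0\<close>.\<close>

lemma word_bound_mono: "k \<le> n \<Longrightarrow> word_bound e (n + k) \<le> word_bound (2 * e + 2) n"
proof -
  assume "k \<le> n"
  then have "n + k + 2 \<le> (n + 2) ^ 2"
    by (simp add: power2_eq_square)
  then have "(n + k + 2) ^ e \<le> ((n + 2) ^ 2) ^ e"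
    by (rule power_mono) simp
  also have "\<dots> \<le> (n + 2) ^ (2 * e + 2)"
    by (simp add: power_mult[symmetric])
  finally show ?thesis
    by (simp add: word_bound_def)
qed

lemma word_bound_large: "n * n < word_bound (2 * e + 2) n" "n < word_bound (2 * e + 2) n"
  "1 < word_bound (2 * e + 2) n"
proof -
  have "(n + 2) ^ 2 \<le> (n + 2) ^ (2 * e + 2)"
    by (rule power_increasing) auto
  then have "(n + 2) ^ 2 \<le> word_bound (2 * e + 2) n"
    by (simp only: word_bound_def)
  then show "n * n < word_bound (2 * e + 2) n" "n < word_bound (2 * e + 2) n"
    "1 < word_bound (2 * e + 2) n"
    by (simp_all add: power2_eq_square)
qed

lemma runs_insert_selection:
  assumes S: "reg S 1 = t" "reg S 5 = 0" "embedded reg_map (arr_map knd) s S"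
    and I: "\<forall>k<t. I k < n" "\<forall>k<t. arr S 2 k = I k" and t: "t \<le> n"
    and s: "serves_all knd e U Q u q n 0 (factors knd t N V (\<lambda>_ _. False)) s"
  shows "runs (word_bound (2 * e + 2) n) (insert_selection knd U) S (t * (u n + 6) + 2)
    (\<lambda>S. reg S 5 = 0 \<and> (\<exists>s. embedded reg_map (arr_map knd) s S \<and>
       serves_all knd e U Q u q n t (factors knd t N V (selection t I 0)) s))"
proof -
  let ?W = "word_bound (2 * e + 2) n"
  \<comment> \<open>Since \<open>k\<close> counts down from \<open>t\<close>, exactly
    \<open>t - k\<close> requests have been served, which fixes the word length available to the
    next one.\<close>
  define Inv where "Inv = (\<lambda>k S. k \<le> t \<and> reg S 1 = k \<and> reg S 4 = 1 \<and> reg S 5 = 0 \<and>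
    (\<forall>k<t. arr S 2 k = I k) \<and> (\<exists>s. embedded reg_map (arr_map knd) s S \<and>
       serves_all knd e U Q u q n (t - k) (factors knd t N V (selection t I k)) s))"
  let ?body = "Seq (Op 1 Sub 1 4) (Seq (Load (fst (pos knd 12 13)) 2 1)
       (Seq (Op (snd (pos knd 12 13)) Add 1 5) (Seq (Const 11 1) (Seq (Const 14 1)
            (rename_com reg_map (arr_map knd) U)))))"
  have body: "runs ?W ?body S (1 + (1 + (1 + (1 + (1 + u n))))) (Inv k)" if inv: "Inv (Suc k) S" for k S
  proof -
    have S: "k < t" "reg S 1 = Suc k" "reg S 4 = 1" "reg S 5 = 0" "\<forall>k<t. arr S 2 k = I k"
      using that by (auto simp: Inv_def)
    obtain s where s: "embedded reg_map (arr_map knd) s S"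
      "serves_all knd e U Q u q n (t - Suc k) (factors knd t N V (selection t I (Suc k))) s"
      using inv unfolding Inv_def by blast
    let ?i = "fst (pos knd (I k) k)" and ?j = "snd (pos knd (I k) k)"
    let ?S = "set_reg 14 1 (set_reg 11 1 (set_reg (snd (pos knd 12 13)) k
      (set_reg (fst (pos knd 12 13)) (I k) (set_reg 1 k S))))"
    have "valid_request n (Update 1 ?i ?j True)"
      using I(1) S(1) t by (cases knd) auto
    from serves_all_Update[OF s(2) this] obtain T s' where s':
      "exec (word_bound e (n + (t - Suc k))) U (give_update 1 ?i ?j True s) T s'" "T \<le> u n"
      "serves_all knd e U Q u q n (t - k) (factors knd t N V (selection t I k)) s'"
      using S(1) by (auto simp: set_entry_factors[OF S(1), simplified] Suc_diff_Suc)
    have "runs ?W (rename_com reg_map (arr_map knd) U) ?S (u n) (Inv k)"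
    proof (rule runs_rename[OF s'(1) _ s'(2) embedded_update[OF s(1)] inj_reg_map inj_arr_map])
      show "word_bound e (n + (t - Suc k)) \<le> ?W"
        using t by (intro word_bound_mono) simp
      fix S'
      assume S': "embedded reg_map (arr_map knd) s' S'" "same_outside reg_map (arr_map knd) ?S S'"
      then have "reg S' r = reg ?S r" if "0 < r" "r \<le> 10" for r
        using that by (simp add: same_outside_def)
      then have "reg S' 1 = k" "reg S' 4 = 1" "reg S' 5 = 0"
        using S by (cases knd; simp)+
      moreover have "arr S' 2 = arr S 2"
        using S'(2) by (simp add: same_outside_def)
      ultimately show "Inv k S'"
        using S' s'(3) S by (auto simp: Inv_def)
    qed
    moreover have "k < ?W"
      using S(1) t word_bound_large(2)[of n e] by linarith
    ultimately show ?thesis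
      using S(2-4) S(5)[rule_format, OF S(1)] word_bound_large(3)[of e n]
      by (cases knd; intro runs_Seq runs_atomic; simp)
  qed
  have start: "Inv t (set_reg 4 1 S)"
  proof -
    have "selection t I t = (\<lambda>_ _. False)"
      by (auto simp: selection_def fun_eq_iff)
    moreover have "embedded reg_map (arr_map knd) s (set_reg 4 1 S)"
      using S(3) by (auto simp: embedded_reg_map)
    ultimately show ?thesis
      using S I s by (auto simp: Inv_def)
  qed
  have "runs ?W (While 1 ?body) (set_reg 4 1 S) (t * Suc (1 + (1 + (1 + (1 + (1 + u n))))) + 1) (Inv 0)"
    by (rule runs_countdown[where I = Inv, OF body _ start]) (auto simp: Inv_def)
  then have "runs ?W (insert_selection knd U) S
      (1 + (t * Suc (1 + (1 + (1 + (1 + (1 + u n))))) + 1)) (Inv 0)"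
    unfolding insert_selection_def using word_bound_large(3)[of e n]
    by (intro runs_Seq runs_atomic)
  then show ?thesis
    by (rule runs_weaken) (auto simp: Inv_def algebra_simps)
qed

lemma runs_query_column:
  assumes S: "reg S 5 = 0" "embedded reg_map (arr_map knd) s S"
    and s: "serves_all knd e U Q u q n t M s" and "j < n" "t \<le> n"
  shows "runs (word_bound (2 * e + 2) n) (query_column knd Q) (set_reg 2 j S) (q n + 1)
    (outputs n (answer knd (triple_product n M) j))"
proof -
  let ?W = "word_bound (2 * e + 2) n"
  obtain T s' where s': "exec (word_bound e (n + t)) Q (set_reg 1 j s) T s'" "T \<le> q n"
    "outputs n (answer knd (triple_product n M) j) s'"
    using serves_all_Query[OF s \<open>j < n\<close>] by blast
  have "embedded reg_map (arr_map knd) (set_reg 1 j s) (set_reg 11 j (set_reg 2 j S))"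
    using S(2) by (auto simp: embedded_reg_map)
  then have "runs ?W (rename_com reg_map (arr_map knd) Q) (set_reg 11 j (set_reg 2 j S)) (q n)
      (outputs n (answer knd (triple_product n M) j))"
  proof (rule runs_rename[OF s'(1) word_bound_mono[OF \<open>t \<le> n\<close>] s'(2) _ inj_reg_map inj_arr_map])
    fix S'
    assume "embedded reg_map (arr_map knd) s' S'"
    then have "arr S' (arr_map knd 3) = arr s' 3"
      by (simp add: embedded_def)
    moreover have "arr_map knd 3 = 3"
      by (cases knd) auto
    ultimately show "outputs n (answer knd (triple_product n M) j) S'"
      using s'(3) by (simp add: outputs_def)
  qed
  then have "runs ?W (query_column knd Q) (set_reg 2 j S) (1 + q n)
      (outputs n (answer knd (triple_product n M) j))"
    unfolding query_column_def using S(1) \<open>j < n\<close> word_bound_large(2)[of n e]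
    by (intro runs_Seq runs_atomic) auto
  then show ?thesis
    by (simp add: add.commute)
qed

lemma solves_by_dynamic_product:
  assumes "maintains_triple_product knd P U Q p u q" and \<tau>: "\<tau> < 1"
  shows "solves_mv_hinted_mv \<tau> (Seq (prelude knd) (rename_com reg_map (arr_map knd) P))
    (insert_selection knd U) (query_column knd Q) (\<lambda>n. 10 * (n * n) + 3 + p n)
    (\<lambda>n. npow n \<tau> * (u n + 6) + 2) (\<lambda>n. q n + 1)"
proof -
  obtain e where e: "\<And>n M. n \<ge> 1 \<Longrightarrow> \<exists>T s. exec (word_bound e n) P (dyn_start n M) T s \<and> T \<le> p n \<and>
      serves_all knd e U Q u q n 0 M s"
    using assms(1) unfolding maintains_triple_product_def serves_all_def by blast
  show ?thesis
    unfolding solves_mv_hinted_mv_def Let_def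
  proof (rule exI[of _ "2 * e + 2"], intro allI impI)
    fix n :: nat and N V
    assume n: "n \<ge> 1"
    define t where "t = npow n \<tau>"
    have t: "t \<le> n"
      using n \<tau> by (simp add: t_def npow_le)
    let ?W = "word_bound (2 * e + 2) n"
    let ?M = "factors knd t N V (\<lambda>_ _. False)"
    obtain T s where s: "exec (word_bound e n) P (dyn_start n ?M) T s" "T \<le> p n"
      "serves_all knd e U Q u q n 0 ?M s"
      using e[OF n] by blast
    define ready where "ready = (\<lambda>S. reg S 1 = t \<and> reg S 5 = 0 \<and> embedded reg_map (arr_map knd) s S)"
    have W: "word_bound e n \<le> ?W"
      using word_bound_mono[of 0 n e] by simp
    have "runs ?W (rename_com reg_map (arr_map knd) P) S (p n) ready"
      if "reg S 1 = t \<and> reg S 5 = 0 \<and> embedded reg_map (arr_map knd) (dyn_start n ?M) S" for S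
      by (rule runs_rename[OF s(1) W s(2) _ inj_reg_map inj_arr_map])
        (use that in \<open>auto simp: ready_def same_outside_def\<close>)
    then have "runs ?W (Seq (prelude knd) (rename_com reg_map (arr_map knd) P)) (hint_start n t N V)
        (10 * (n * n) + 3 + p n) ready"
      by (intro runs_Seq runs_weaken[OF runs_prelude[OF word_bound_large t]]) auto
    then obtain T1 S1 where S1: "exec ?W (Seq (prelude knd) (rename_com reg_map (arr_map knd) P))
        (hint_start n t N V) T1 S1" "T1 \<le> 10 * (n * n) + 3 + p n" "ready S1"
      unfolding runs_def by blast
    have phase2: "\<exists>T2 S2. exec ?W (insert_selection knd U) (hint_give_I t I S1) T2 S2 \<and>
        T2 \<le> t * (u n + 6) + 2 \<and>
        (\<forall>j<n. \<exists>T3 S3. exec ?W (query_column knd Q) (set_reg 2 j S2) T3 S3 \<and> T3 \<le> q n + 1 \<and>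
           outputs n (bmult_vec t (select_cols N I) (column V j)) S3)" if I: "\<forall>k<t. I k < n" for I
    proof -
      have "embedded reg_map (arr_map knd) s (hint_give_I t I S1)"
        using S1(3) by (simp add: embedded_def ready_def hint_give_I_def)
      then have "runs ?W (insert_selection knd U) (hint_give_I t I S1) (t * (u n + 6) + 2)
        (\<lambda>S. reg S 5 = 0 \<and> (\<exists>s. embedded reg_map (arr_map knd) s S \<and>
           serves_all knd e U Q u q n t (factors knd t N V (selection t I 0)) s))"
        using S1(3) I t s(3)
        by (intro runs_insert_selection) (auto simp: ready_def hint_give_I_def)
      then obtain T2 S2 s2 where S2: "exec ?W (insert_selection knd U) (hint_give_I t I S1) T2 S2"
        "T2 \<le> t * (u n + 6) + 2" "reg S2 5 = 0" "embedded reg_map (arr_map knd) s2 S2"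
        "serves_all knd e U Q u q n t (factors knd t N V (selection t I 0)) s2"
        unfolding runs_def by blast
      \<comment> \<open>Every \<open>j\<close> starts from the same state \<open>S2\<close>, so each
        query directly follows the \<open>t\<close> updates and nothing has to be undone.\<close>
      have "\<exists>T3 S3. exec ?W (query_column knd Q) (set_reg 2 j S2) T3 S3 \<and> T3 \<le> q n + 1 \<and>
           outputs n (bmult_vec t (select_cols N I) (column V j)) S3" if "j < n" for j
        using runs_query_column[OF S2(3-5) that t]
        unfolding runs_def answer_factors[OF I t] .
      then show ?thesis
        using S2(1,2) by blast
    qed
    show "\<exists>T1 s1. exec ?W (Seq (prelude knd) (rename_com reg_map (arr_map knd) P))
        (hint_start n (npow n \<tau>) N V) T1 s1 \<and> T1 \<le> 10 * (n * n) + 3 + p n \<and>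
        (\<forall>I. (\<forall>k<npow n \<tau>. I k < n) \<longrightarrow>
          (\<exists>T2 s2. exec ?W (insert_selection knd U) (hint_give_I (npow n \<tau>) I s1) T2 s2 \<and>
             T2 \<le> npow n \<tau> * (u n + 6) + 2 \<and>
             (\<forall>j<n. \<exists>T3 s3. exec ?W (query_column knd Q) (set_reg 2 j s2) T3 s3 \<and> T3 \<le> q n + 1 \<and>
                outputs n (bmult_vec (npow n \<tau>) (select_cols N I) (column V j)) s3)))"
      unfolding t_def[symmetric] using S1 phase2 by blast
  qed
qed

section \<open>Asymptotic bookkeeping and conclusion\<close>

lemma const_bigo_powr:
  assumes "a \<ge> 0"
  shows "(\<lambda>_. c :: real) \<in> O(\<lambda>n. real n powr a)"
proof (rule bigoI[of _ "\<bar>c\<bar>"], rule eventually_mono[OF eventually_gt_at_top[of 0]])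
  fix n :: nat
  assume "n > 0"
  then have "1 \<le> real n powr a"
    using assms by (simp add: ge_one_powr_ge_zero)
  then show "norm c \<le> \<bar>c\<bar> * norm (real n powr a)"
    by (simp add: mult_le_cancel_left1)
qed

lemma time_exponent_mono: "time_exponent f a \<Longrightarrow> a \<le> b \<Longrightarrow> time_exponent f b"
  unfolding time_exponent_def
  by (erule landau_o.big_trans) (simp add: powr_bigo_iff filterlim_real_sequentially)

lemma has_dynamic_algorithm_mono:
  "has_dynamic_algorithm knd \<alpha> \<beta> \<Longrightarrow> \<alpha> \<le> \<alpha>' \<Longrightarrow> \<beta> \<le> \<beta>' \<Longrightarrow> has_dynamic_algorithm knd \<alpha>' \<beta>'"
  unfolding has_dynamic_algorithm_def by (meson time_exponent_mono)

lemma time_exponent_add_const: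
  assumes "time_exponent f a" "a \<ge> 0"
  shows "time_exponent (\<lambda>n. f n + c) a"
  using sum_in_bigo(1)[OF assms(1)[unfolded time_exponent_def] const_bigo_powr[OF assms(2), of "real c"]]
  by (simp add: time_exponent_def)

lemma time_exponent_mult:
  assumes "time_exponent f a" "time_exponent g b"
  shows "time_exponent (\<lambda>n. f n * g n) (a + b)"
  using landau_o.big.mult[OF assms[unfolded time_exponent_def]]
  by (simp add: time_exponent_def powr_add)

lemma poly_bounded_prelude:
  assumes "poly_bounded p"
  shows "poly_bounded (\<lambda>n. 10 * (n * n) + 3 + p n)"
proof -
  obtain k :: nat where k: "(\<lambda>n. real (p n)) \<in> O(\<lambda>n. real n ^ k)"
    using assms unfolding poly_bounded_def by blast
  have mono: "(\<lambda>n. real n ^ i) \<in> O(\<lambda>n. real n ^ (k + 2))" if "i \<le> k + 2" for i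
  proof (rule bigoI[of _ 1], rule eventually_mono[OF eventually_gt_at_top[of 0]])
    fix n :: nat
    assume "n > 0"
    then show "norm (real n ^ i) \<le> 1 * norm (real n ^ (k + 2))"
      using power_increasing[OF that, of "real n"] by simp
  qed
  have "(\<lambda>n. 10 * real n ^ 2 + 3 * real n ^ 0 + real (p n)) \<in> O(\<lambda>n. real n ^ (k + 2))"
    by (intro sum_in_bigo landau_o.big.cmult_in_iff[THEN iffD2] mono landau_o.big_trans[OF k]) auto
  then show ?thesis
    unfolding poly_bounded_def by (auto simp: power2_eq_square intro!: exI[of _ "k + 2"])
qed

lemma no_dynamic_algorithm:
  assumes "mv_hinted_mv_conjecture" and \<tau>: "0 < \<tau>" "\<tau> < 1" and "0 < \<epsilon>"
  shows "\<not> has_dynamic_algorithm knd (omega 1 1 \<tau> - \<tau> - \<epsilon>) (1 + \<tau> - \<epsilon>)"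
proof
  \<comment> \<open>Capping at 1 weakens the assumed bounds but keeps all exponents nonnegative,
    because the matrix exponent is at least \<open>1 + \<tau>\<close>; the additive constants of the
    simulation are then absorbed.\<close>
  define \<delta> where "\<delta> = min \<epsilon> 1"
  have \<delta>: "0 < \<delta>" "\<delta> \<le> \<epsilon>" "\<delta> \<le> 1"
    using \<open>0 < \<epsilon>\<close> by (auto simp: \<delta>_def)
  assume "has_dynamic_algorithm knd (omega 1 1 \<tau> - \<tau> - \<epsilon>) (1 + \<tau> - \<epsilon>)"
  then have "has_dynamic_algorithm knd (omega 1 1 \<tau> - \<tau> - \<delta>) (1 + \<tau> - \<delta>)"
    by (rule has_dynamic_algorithm_mono) (use \<delta> in auto)
  then obtain P U Q p u q where alg: "maintains_triple_product knd P U Q p u q"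
    and p: "poly_bounded p" and u: "time_exponent u (omega 1 1 \<tau> - \<tau> - \<delta>)"
    and q: "time_exponent q (1 + \<tau> - \<delta>)"
    unfolding has_dynamic_algorithm_def by blast
  have "time_exponent (\<lambda>n. npow n \<tau>) \<tau>"
    unfolding time_exponent_def using \<tau> by (intro npow_bigo) simp
  then have "time_exponent (\<lambda>n. npow n \<tau> * (u n + 6)) (\<tau> + (omega 1 1 \<tau> - \<tau> - \<delta>))"
    using omega_rotate(2)[OF \<tau>] \<delta> u by (intro time_exponent_mult time_exponent_add_const) auto
  then have "time_exponent (\<lambda>n. npow n \<tau> * (u n + 6) + 2) (\<tau> + (omega 1 1 \<tau> - \<tau> - \<delta>))"
    using omega_rotate(2)[OF \<tau>] \<tau> \<delta> by (intro time_exponent_add_const) auto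
  then have f2: "time_exponent (\<lambda>n. npow n \<tau> * (u n + 6) + 2) (omega 1 \<tau> 1 - \<delta>)"
    by (rule time_exponent_mono) (use omega_rotate(1)[OF \<tau>] in simp)
  have f3: "time_exponent (\<lambda>n. q n + 1) (1 + \<tau> - \<delta>)"
    using q \<tau> \<delta> by (intro time_exponent_add_const) auto
  show False
    using assms(1) \<tau> \<delta>(1) solves_by_dynamic_product[OF alg \<tau>(2)] poly_bounded_prelude[OF p] f2 f3
    unfolding mv_hinted_mv_conjecture_def by blast
qed

text \<open>Numerical bounds on the exponent locate the balancing point only approximately;
  \<open>\<delta>\<close> absorbs that deviation from 1.529.\<close>

theorem theorem5p8:
  assumes "mv_hinted_mv_conjecture"
  shows "(\<forall>\<tau> \<epsilon>. 0 < \<tau> \<and> \<tau> < 1 \<and> 0 < \<epsilon> \<longrightarrow>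
            \<not> has_dynamic_algorithm ColumnQuery (omega 1 1 \<tau> - \<tau> - \<epsilon>) (1 + \<tau> - \<epsilon>)) \<and>
         (\<forall>\<tau> \<epsilon>. 0 < \<tau> \<and> \<tau> < 1 \<and> 0 < \<epsilon> \<longrightarrow>
            \<not> has_dynamic_algorithm RowQuery (omega 1 1 \<tau> - \<tau> - \<epsilon>) (1 + \<tau> - \<epsilon>)) \<and>
         (\<forall>\<tau> \<delta> \<epsilon> knd. 0 < \<tau> \<and> \<tau> < 1 \<and> 0 < \<epsilon> \<and>
            omega 1 1 \<tau> - \<tau> = 1 + \<tau> \<and> \<bar>(1 + \<tau>) - 1.529\<bar> \<le> \<delta> \<longrightarrow>
            \<not> has_dynamic_algorithm knd (1 + \<tau> - \<epsilon>) (1 + \<tau> - \<epsilon>) \<and>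
            \<not> has_dynamic_algorithm knd (1.529 - \<delta> - \<epsilon>) (1.529 - \<delta> - \<epsilon>))"
proof (intro conjI allI impI; (elim conjE)?)
  fix \<tau> \<delta> \<epsilon> :: real and knd
  assume *: "0 < \<tau>" "\<tau> < 1" "0 < \<epsilon>" "omega 1 1 \<tau> - \<tau> = 1 + \<tau>" "\<bar>(1 + \<tau>) - 1.529\<bar> \<le> \<delta>"
  show balanced: "\<not> has_dynamic_algorithm knd (1 + \<tau> - \<epsilon>) (1 + \<tau> - \<epsilon>)"
    using no_dynamic_algorithm[OF assms *(1-3), of knd] *(4) by simp
  \<comment> \<open>As \<open>1.529 - \<delta> \<le> 1 + \<tau>\<close>, an algorithm this fast
    would also meet the balanced bounds.\<close>
  show "\<not> has_dynamic_algorithm knd (1.529 - \<delta> - \<epsilon>) (1.529 - \<delta> - \<epsilon>)"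
    using balanced has_dynamic_algorithm_mono[of knd "1.529 - \<delta> - \<epsilon>" "1.529 - \<delta> - \<epsilon>" "1 + \<tau> - \<epsilon>" "1 + \<tau> - \<epsilon>"]
      *(5) by linarith
qed (use no_dynamic_algorithm[OF assms] in blast)+

end
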